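(* Suppose that $J$ and $E$ are degree-related with $|e_J|\le 2$ for every $e\in E$, that each $\varphi_e$ is concentrated on $e$, and that $C_\Phi:=\sup_{e\in E}\|\varphi_e\|_\infty<\infty$. Let $\mathcal{Y}$ be an admissible set family. Then: (i) for $p,q\ge1$, the function $r\mapsto\big(\tfrac{1}{2C_\Phi}\,c(\Phi_{pr},\widetilde{\llbracket\cdot\rrbracket}_{qr})\big)^r$ is decreasing in $r\ge1$; (ii) for $p,q,s,t\ge1$ with $ps'=qt'$ ($s',t'$ the Hölder conjugates of $s,t$), $$(2C_\Phi)^{1-t}\,c(\Phi_{pt},\widetilde{\llbracket\cdot\rrbracket}_{qt})^t\le c(\Phi_p,\widetilde{\llbracket\cdot\rrbracket}_q)\le t\cdot c(\Phi_{ps},\widetilde{\llbracket\cdot\rrbracket}_{qt}),$$ and this inequality still holds when the condition $|e_J|\le2$ is replaced with $p=q=1$; (iii) $p\mapsto\eta(E)^{-1/p}c(\Phi_p,\widetilde{\llbracket\cdot\rrbracket}_q)$ is increasing, and $q\mapsto\eta(E)^{1/q}c(\Phi_p,\widetilde{\llbracket\cdot\rrbracket}_q)$ is decreasing. Properties (i), (ii) and (iii) still hold for $c(\Phi_p,\llbracket\cdot\rrbracket_q)$ in place of $c(\Phi_p,\widetilde{\llbracket\cdot\rrbracket}_q)$, and for $c(\Psi_p,\widetilde{\llbracket\cdot\rrbracket}_q)$ or $c(\Psi_p,\llbracket\cdot\rrbracket_q)$ (with set-pair functions $\psi_e$ concentrated on $e$, and $C_\Psi:=\sup_{e\in E}\|\psi_e\|_\infty<\infty$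 in place of $C_\Phi$).
   Context: $(J,\mathcal{B},\mu)$ is a measure space with $0<\mu(J)<\infty$; $\mathrm{Bd}$ is the space of bounded measurable $f:J\to\mathbb{R}$; $(E,\eta)$ is a measure space (with $0<\eta(E)<\infty$ where powers of $\eta(E)$ appear). "Increasing/decreasing" are in the weak sense. $J$ and $E$ form a finitely related structure if there is a correspondence $E\rightrightarrows J$ such that each $e\in E$ corresponds to finitely many elements of $J$; write $e_J=\{x\in J: e\text{ corresponds to }x\}$. They are degree-related if, in addition, there is a degree function $\deg:J\to[0,\infty)$ with $\int_E\sum_{x\in e_J}g(x)\,d\eta(e)=\int_J\deg(x)g(x)\,d\mu(x)$ for every $g\in\mathrm{Bd}$. $\varphi_e:\mathcal{B}\to[0,\infty)$, $\varphi_e(J)=\varphi_e(\varnothing)=0$; $\varphi_e$ is concentrated on $e$ if $\varphi_e(B)=\varphi_e(B\cap e_J)$ for all $B\in\mathcal{B}$. $\psi_e:\mathcal{B}\times\mathcal{B}\to[0,\infty)$, $\psi_e(\varnothing,\varnothing)=0$; $\psi_e$ is concentrated on $e$ if $\psi_e(B,B')=\psi_e(B\cap e_J,B'\cap e_J)$ for all disjoint $B,B'\in\mathcal{B}$. $\|\cdot\|_\infty$ denotes the supremum of the absolute value. $\widehat{\varphi}_e(f)=\int_{\inf f}^\infty\varphi_e\{f\ge t\}\,dt+\varphi_e(J)\inf f$; $\widehat{\psi}_e(f)=\int_0^\infty\psi_e(\{f\ge t\},\{f\le -t\})\,dt$; $\Phi_p(f)=\big(\int_E\widehat{\varphi}_e(f)^p\,d\eta\big)^{1/p}$;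 $\Psi_p(f)=\big(\int_E\widehat{\psi}_e(f)^p\,d\eta\big)^{1/p}$ (integrability and measurability needed for these definitions are assumed). Norms: $\widetilde{\llbracket f\rrbracket}_p=\big(\int_J\widetilde{\deg}(x)|f(x)|^p\,d\mu(x)\big)^{1/p}$, where $\widetilde{\deg}$ is a degree function satisfying the identity in the definition of degree-related. For set functions $\llbracket f\rrbracket_p=\big(\int_E|f|_{\varphi_e}^p\,d\eta\big)^{1/p}$ with $|f|_{\varphi_e}=\inf\{t>0:\varphi_e\{f\ge s\}=\varphi_e\{f\ge -s\}=0\ \forall s\ge t\}$; for set-pair functions $\llbracket f\rrbracket_p=\big(\int_E\|f\|_{\psi_e}^p\,d\eta\big)^{1/p}$ with $\|f\|_{\psi_e}=\inf\{t>0:\psi_e(\{f\ge s\},\{f\le -s\})=0\ \forall s\ge t\}$. Mazur map: $f^r(x)=|f(x)|^r\,\mathrm{sign}(f(x))$. $\mathcal{Y}\subset2^{\mathrm{Bd}}$ is admissible if $Y\in\mathcal{Y}$ implies $\{f^r:f\in Y\}\in\mathcal{Y}$ for all $r>0$. For a functional $F\in\{\Phi_p,\Psi_p\}$ and a norm $N\in\{\widetilde{\llbracket\cdot\rrbracket}_q,\llbracket\cdot\rrbracket_q\}$ (where $\llbracket\cdot\rrbracket_q$ is the set-function version, built from $|f|_{\varphi_e}$, if $F=\Phi_p$, and the set-pair version, built from $\|f\|_{\psi_e}$, if $F=\Psi_p$), $c(F,N)=\inf_{Y\in\mathcal{Y}}\sup_{f\in Y}F(f)/N(f)$, where the supremum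 is over $f\in Y$ with $0<N(f)<\infty$ and sets $Y$ containing no such $f$ are discarded.
   Formalization: The claim in (iii) that η(E)^{1/q}c is decreasing in q is false for the degree norm; for that norm it is proved when D = ∫deg dμ ≤ η(E), and in general with D^{1/q} in place of η(E)^{1/q}. *)

theory Defs
  imports "HOL-Analysis.Analysis"
begin

section \<open>Powers with values in the extended nonnegative reals\<close>

text \<open>The usual conventions \<open>0 ^ a = \<infinity>\<close> for \<open>a < 0\<close>, \<open>x ^ 0 = 1\<close>, and dually for \<open>\<infinity>\<close>.\<close>

definition epowr :: "ennreal \<Rightarrow> real \<Rightarrow> ennreal" where
  "epowr x a =
     (if a = 0 then 1
      else if x = 0 then (if a > 0 then 0 else top)
      else if x = top then (if a > 0 then top else 0)
      else ennreal (enn2real x powr a))"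

definition hoelder_conj :: "real \<Rightarrow> ennreal" where
  "hoelder_conj s = (if s = 1 then top else ennreal (s / (s - 1)))"


section \<open>Finitely related and degree-related structures\<close>

definition Bd :: "'j measure \<Rightarrow> ('j \<Rightarrow> real) set" where
  "Bd J = {f \<in> borel_measurable J. \<exists>b. \<forall>x\<in>space J. \<bar>f x\<bar> \<le> b}"

text \<open>The correspondence is given by the map \<open>e \<mapsto> e\<^sub>J\<close>, here \<open>eJ\<close>.\<close>

definition finitely_related ::
  "'j measure \<Rightarrow> 'e measure \<Rightarrow> ('e \<Rightarrow> 'j set) \<Rightarrow> bool" where
  "finitely_related J E eJ \<longleftrightarrow> (\<forall>e\<in>space E. eJ e \<subseteq> space J \<and> finite (eJ e))"

text \<open>
  The integral identity is stated in \<open>[0, \<infinity>]\<close> for nonnegative \<open>g\<close>, so that it makes sense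
  even if the degree function has infinite integral. If \<open>dg\<close> is integrable, this is the
  same as the identity of (finite) integrals for all \<open>g \<in> Bd J\<close>; see
  \<open>is_degree_function_iff\<close> below.
\<close>

definition is_degree_function ::
  "'j measure \<Rightarrow> 'e measure \<Rightarrow> ('e \<Rightarrow> 'j set) \<Rightarrow> ('j \<Rightarrow> real) \<Rightarrow> bool" where
  "is_degree_function J E eJ dg \<longleftrightarrow>
     dg \<in> borel_measurable J \<and> (\<forall>x\<in>space J. 0 \<le> dg x) \<and>
     (\<forall>g\<in>Bd J. (\<lambda>e. \<Sum>x\<in>eJ e. g x) \<in> borel_measurable E) \<and>
     (\<forall>g\<in>Bd J. (\<forall>x\<in>space J. 0 \<le> g x) \<longrightarrow>
        (\<integral>\<^sup>+e. ennreal (\<Sum>x\<in>eJ e. g x) \<partial>E) = (\<integral>\<^sup>+x. ennreal (dg x * g x) \<partial>J))"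

definition degree_related ::
  "'j measure \<Rightarrow> 'e measure \<Rightarrow> ('e \<Rightarrow> 'j set) \<Rightarrow> ('j \<Rightarrow> real) \<Rightarrow> bool" where
  "degree_related J E eJ dg \<longleftrightarrow> finitely_related J E eJ \<and> is_degree_function J E eJ dg"

lemma is_degree_function_iff:
  assumes "finitely_related J E eJ" "dg \<in> borel_measurable J" "\<forall>x\<in>space J. 0 \<le> dg x"
  shows "is_degree_function J E eJ dg \<and> integrable J dg \<longleftrightarrow>
    (\<forall>g\<in>Bd J. integrable E (\<lambda>e. \<Sum>x\<in>eJ e. g x) \<and> integrable J (\<lambda>x. dg x * g x) \<and>
       (\<integral>e. (\<Sum>x\<in>eJ e. g x) \<partial>E) = (\<integral>x. dg x * g x \<partial>J))"
    (is "?L \<longleftrightarrow> ?R")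
proof
  have sum0: "0 \<le> (\<Sum>x\<in>eJ e. g x)" if "e \<in> space E" "\<forall>x\<in>space J. 0 \<le> g x" for e and g :: "'a \<Rightarrow> real"
    using that assms(1) by (intro sum_nonneg) (auto simp: finitely_related_def)
  have one: "(\<lambda>_. 1) \<in> Bd J" by (auto simp: Bd_def)
  {
    assume ?R
    have "integrable J (\<lambda>x. dg x * 1)" using bspec[OF \<open>?R\<close> one] by blast
    moreover have "(\<integral>\<^sup>+e. ennreal (\<Sum>x\<in>eJ e. g x) \<partial>E) = (\<integral>\<^sup>+x. ennreal (dg x * g x) \<partial>J)"
      if g: "g \<in> Bd J" "\<forall>x\<in>space J. 0 \<le> g x" for g
    proof -
      have "(\<integral>\<^sup>+e. ennreal (\<Sum>x\<in>eJ e. g x) \<partial>E) = ennreal (\<integral>e. (\<Sum>x\<in>eJ e. g x) \<partial>E)"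
        using \<open>?R\<close> g sum0 by (intro nn_integral_eq_integral) auto
      also have "\<dots> = ennreal (\<integral>x. dg x * g x \<partial>J)" using \<open>?R\<close> g by auto
      also have "\<dots> = (\<integral>\<^sup>+x. ennreal (dg x * g x) \<partial>J)"
        using \<open>?R\<close> g assms by (intro nn_integral_eq_integral[symmetric]) auto
      finally show ?thesis .
    qed
    ultimately show ?L
      using \<open>?R\<close> assms by (auto simp: is_degree_function_def)
  }
  assume ?L
  then have D: "is_degree_function J E eJ dg" and int: "integrable J dg" by auto
  have pos: "integrable E (\<lambda>e. \<Sum>x\<in>eJ e. g x) \<and> integrable J (\<lambda>x. dg x * g x) \<and>
       (\<integral>e. (\<Sum>x\<in>eJ e. g x) \<partial>E) = (\<integral>x. dg x * g x \<partial>J)"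
    if g: "g \<in> Bd J" "\<forall>x\<in>space J. 0 \<le> g x" for g
  proof -
    obtain b where b: "\<forall>x\<in>space J. \<bar>g x\<bar> \<le> b" and gm: "g \<in> borel_measurable J"
      using g by (auto simp: Bd_def)
    have I: "integrable J (\<lambda>x. dg x * g x)"
    proof (rule Bochner_Integration.integrable_bound)
      show "integrable J (\<lambda>x. b * dg x)" using int by simp
      show "(\<lambda>x. dg x * g x) \<in> borel_measurable J" using gm assms(2) by measurable
      show "AE x in J. norm (dg x * g x) \<le> norm (b * dg x)"
      proof (intro AE_I2)
        fix x assume "x \<in> space J"
        then have "\<bar>g x\<bar> \<le> \<bar>b\<bar>" using b by force
        then have "\<bar>g x\<bar> * \<bar>dg x\<bar> \<le> \<bar>b\<bar> * \<bar>dg x\<bar>" by (intro mult_right_mono) auto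
        then show "norm (dg x * g x) \<le> norm (b * dg x)" by (simp add: abs_mult mult.commute)
      qed
    qed
    have S: "(\<lambda>e. \<Sum>x\<in>eJ e. g x) \<in> borel_measurable E"
      using D g by (auto simp: is_degree_function_def)
    have eq: "(\<integral>\<^sup>+e. ennreal (\<Sum>x\<in>eJ e. g x) \<partial>E) = ennreal (\<integral>x. dg x * g x \<partial>J)"
      using D g I assms
      by (subst nn_integral_eq_integral[symmetric]) (auto simp: is_degree_function_def)
    have nn: "0 \<le> (\<integral>x. dg x * g x \<partial>J)"
      using g assms by (intro Bochner_Integration.integral_nonneg) auto
    have "has_bochner_integral E (\<lambda>e. \<Sum>x\<in>eJ e. g x) (\<integral>x. dg x * g x \<partial>J)"
      using S eq nn sum0 g by (intro has_bochner_integral_nn_integral) auto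
    with I show ?thesis by (auto simp: has_bochner_integral_iff)
  qed
  show ?R
  proof
    fix g assume g: "g \<in> Bd J"
    define u where "u = (\<lambda>x. max 0 (g x))"
    define v where "v = (\<lambda>x. max 0 (- g x))"
    obtain b where b: "\<forall>x\<in>space J. \<bar>g x\<bar> \<le> b" and gm: "g \<in> borel_measurable J"
      using g by (auto simp: Bd_def)
    have "\<bar>u x\<bar> \<le> b" "\<bar>v x\<bar> \<le> b" if "x \<in> space J" for x
      using bspec[OF b that] by (auto simp: u_def v_def max_def)
    moreover have "u \<in> borel_measurable J" "v \<in> borel_measurable J"
      using gm by (auto simp: u_def v_def)
    ultimately have uv: "u \<in> Bd J" "v \<in> Bd J" by (auto simp: Bd_def)
    have guv: "g = (\<lambda>x. u x - v x)" by (auto simp: u_def v_def max_def)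
    have P: "\<forall>x\<in>space J. 0 \<le> u x" "\<forall>x\<in>space J. 0 \<le> v x" by (auto simp: u_def v_def)
    note pu = pos[OF uv(1) P(1)] and pv = pos[OF uv(2) P(2)]
    show "integrable E (\<lambda>e. \<Sum>x\<in>eJ e. g x) \<and> integrable J (\<lambda>x. dg x * g x) \<and>
       (\<integral>e. (\<Sum>x\<in>eJ e. g x) \<partial>E) = (\<integral>x. dg x * g x \<partial>J)"
      unfolding guv right_diff_distrib sum_subtractf using pu pv by auto
  qed
qed


section \<open>Set functions, set-pair functions and their extensions\<close>

definition set_function :: "'j measure \<Rightarrow> ('j set \<Rightarrow> real) \<Rightarrow> bool" where
  "set_function J \<phi> \<longleftrightarrow> (\<forall>B\<in>sets J. 0 \<le> \<phi> B) \<and> \<phi> (space J) = 0 \<and> \<phi> {} = 0"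

definition concentrated :: "'j measure \<Rightarrow> 'j set \<Rightarrow> ('j set \<Rightarrow> real) \<Rightarrow> bool" where
  "concentrated J K \<phi> \<longleftrightarrow> (\<forall>B\<in>sets J. \<phi> B = \<phi> (B \<inter> K))"

definition set_pair_function :: "'j measure \<Rightarrow> ('j set \<Rightarrow> 'j set \<Rightarrow> real) \<Rightarrow> bool" where
  "set_pair_function J \<psi> \<longleftrightarrow> (\<forall>A\<in>sets J. \<forall>B\<in>sets J. 0 \<le> \<psi> A B) \<and> \<psi> {} {} = 0"

definition pair_concentrated ::
  "'j measure \<Rightarrow> 'j set \<Rightarrow> ('j set \<Rightarrow> 'j set \<Rightarrow> real) \<Rightarrow> bool" where
  "pair_concentrated J K \<psi> \<longleftrightarrow>
     (\<forall>A\<in>sets J. \<forall>B\<in>sets J. A \<inter> B = {} \<longrightarrow> \<psi> A B = \<psi> (A \<inter> K) (B \<inter> K))"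

definition C_Phi :: "'j measure \<Rightarrow> 'e measure \<Rightarrow> ('e \<Rightarrow> 'j set \<Rightarrow> real) \<Rightarrow> ennreal" where
  "C_Phi J E \<phi> = (SUP e\<in>space E. SUP B\<in>sets J. ennreal \<bar>\<phi> e B\<bar>)"

definition C_Psi :: "'j measure \<Rightarrow> 'e measure \<Rightarrow> ('e \<Rightarrow> 'j set \<Rightarrow> 'j set \<Rightarrow> real) \<Rightarrow> ennreal" where
  "C_Psi J E \<psi> = (SUP e\<in>space E. SUP A\<in>sets J. SUP B\<in>sets J. ennreal \<bar>\<psi> e A B\<bar>)"

definition lovasz :: "'j measure \<Rightarrow> ('j set \<Rightarrow> real) \<Rightarrow> ('j \<Rightarrow> real) \<Rightarrow> real" where
  "lovasz J \<phi> f =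
     (LINT t:{Inf (f ` space J)..}|lborel. \<phi> {x\<in>space J. f x \<ge> t})
       + \<phi> (space J) * Inf (f ` space J)"

definition pair_lovasz :: "'j measure \<Rightarrow> ('j set \<Rightarrow> 'j set \<Rightarrow> real) \<Rightarrow> ('j \<Rightarrow> real) \<Rightarrow> real" where
  "pair_lovasz J \<psi> f =
     (LINT t:{0..}|lborel. \<psi> {x\<in>space J. f x \<ge> t} {x\<in>space J. f x \<le> - t})"

definition Phi ::
  "'j measure \<Rightarrow> 'e measure \<Rightarrow> ('e \<Rightarrow> 'j set \<Rightarrow> real) \<Rightarrow> real \<Rightarrow> ('j \<Rightarrow> real) \<Rightarrow> ennreal" where
  "Phi J E \<phi> p f = epowr (\<integral>\<^sup>+e. ennreal (lovasz J (\<phi> e) f powr p) \<partial>E) (1 / p)"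

definition Psi ::
  "'j measure \<Rightarrow> 'e measure \<Rightarrow> ('e \<Rightarrow> 'j set \<Rightarrow> 'j set \<Rightarrow> real) \<Rightarrow> real \<Rightarrow> ('j \<Rightarrow> real) \<Rightarrow> ennreal" where
  "Psi J E \<psi> p f = epowr (\<integral>\<^sup>+e. ennreal (pair_lovasz J (\<psi> e) f powr p) \<partial>E) (1 / p)"


section \<open>Norms\<close>

definition deg_norm :: "'j measure \<Rightarrow> ('j \<Rightarrow> real) \<Rightarrow> real \<Rightarrow> ('j \<Rightarrow> real) \<Rightarrow> ennreal" where
  "deg_norm J dg p f = epowr (\<integral>\<^sup>+x. ennreal (dg x * \<bar>f x\<bar> powr p) \<partial>J) (1 / p)"

definition abs_set :: "'j measure \<Rightarrow> ('j set \<Rightarrow> real) \<Rightarrow> ('j \<Rightarrow> real) \<Rightarrow> real" where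
  "abs_set J \<phi> f =
     Inf {t. t > 0 \<and> (\<forall>s\<ge>t. \<phi> {x\<in>space J. f x \<ge> s} = 0 \<and> \<phi> {x\<in>space J. f x \<ge> - s} = 0)}"

definition abs_pair :: "'j measure \<Rightarrow> ('j set \<Rightarrow> 'j set \<Rightarrow> real) \<Rightarrow> ('j \<Rightarrow> real) \<Rightarrow> real" where
  "abs_pair J \<psi> f =
     Inf {t. t > 0 \<and> (\<forall>s\<ge>t. \<psi> {x\<in>space J. f x \<ge> s} {x\<in>space J. f x \<le> - s} = 0)}"

definition set_norm ::
  "'j measure \<Rightarrow> 'e measure \<Rightarrow> ('e \<Rightarrow> 'j set \<Rightarrow> real) \<Rightarrow> real \<Rightarrow> ('j \<Rightarrow> real) \<Rightarrow> ennreal" where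
  "set_norm J E \<phi> p f = epowr (\<integral>\<^sup>+e. ennreal (abs_set J (\<phi> e) f powr p) \<partial>E) (1 / p)"

definition pair_norm ::
  "'j measure \<Rightarrow> 'e measure \<Rightarrow> ('e \<Rightarrow> 'j set \<Rightarrow> 'j set \<Rightarrow> real) \<Rightarrow> real \<Rightarrow> ('j \<Rightarrow> real) \<Rightarrow> ennreal" where
  "pair_norm J E \<psi> p f = epowr (\<integral>\<^sup>+e. ennreal (abs_pair J (\<psi> e) f powr p) \<partial>E) (1 / p)"


section \<open>Admissible families and the min-max constant\<close>

definition mazur :: "real \<Rightarrow> ('j \<Rightarrow> real) \<Rightarrow> 'j \<Rightarrow> real" where
  "mazur r f = (\<lambda>x. \<bar>f x\<bar> powr r * sgn (f x))"

definition admissible :: "'j measure \<Rightarrow> ('j \<Rightarrow> real) set set \<Rightarrow> bool" where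
  "admissible J \<Y> \<longleftrightarrow> (\<forall>Y\<in>\<Y>. Y \<subseteq> Bd J) \<and> (\<forall>Y\<in>\<Y>. \<forall>r>0. mazur r ` Y \<in> \<Y>)"

text \<open>If all sets of the family are discarded, the infimum is \<open>\<infinity>\<close>.\<close>

definition minimax ::
  "('j \<Rightarrow> real) set set \<Rightarrow> (('j \<Rightarrow> real) \<Rightarrow> ennreal) \<Rightarrow> (('j \<Rightarrow> real) \<Rightarrow> ennreal) \<Rightarrow> ennreal" where
  "minimax \<Y> F N =
     (INF Y\<in>{Y\<in>\<Y>. \<exists>f\<in>Y. 0 < N f \<and> N f < top}.
        SUP f\<in>{f\<in>Y. 0 < N f \<and> N f < top}. F f / N f)"


section \<open>The monotonicity properties\<close>

text \<open>
  Below, \<open>c p q\<close> stands for \<open>c(\<Phi>\<^sub>p, N\<^sub>q)\<close> or \<open>c(\<Psi>\<^sub>p, N\<^sub>q)\<close>, and \<open>C\<close> for \<open>C\<^sub>\<Phi>\<close> or \<open>C\<^sub>\<Psi>\<close>.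
\<close>

definition power_decreasing :: "ennreal \<Rightarrow> (real \<Rightarrow> real \<Rightarrow> ennreal) \<Rightarrow> bool" where
  "power_decreasing C c \<longleftrightarrow>
     (\<forall>p\<ge>1. \<forall>q\<ge>1. antimono_on {1..} (\<lambda>r. epowr (1 / (2 * C) * c (p * r) (q * r)) r))"

definition two_sided_bound ::
  "ennreal \<Rightarrow> (real \<Rightarrow> real \<Rightarrow> ennreal) \<Rightarrow> real \<Rightarrow> real \<Rightarrow> bool" where
  "two_sided_bound C c p q \<longleftrightarrow>
     (\<forall>s\<ge>1. \<forall>t\<ge>1. ennreal p * hoelder_conj s = ennreal q * hoelder_conj t \<longrightarrow>
        epowr (2 * C) (1 - t) * epowr (c (p * t) (q * t)) t \<le> c p q \<and>
        c p q \<le> ennreal t * c (p * s) (q * t))"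

definition increasing_in_p :: "ennreal \<Rightarrow> (real \<Rightarrow> real \<Rightarrow> ennreal) \<Rightarrow> bool" where
  "increasing_in_p m c \<longleftrightarrow> (\<forall>q\<ge>1. mono_on {1..} (\<lambda>p. epowr m (- (1 / p)) * c p q))"

text \<open>
  Decrease in \<open>q\<close> comes from Jensen's inequality for the measure that defines the norm, and
  \<open>m\<close> has to be its total mass. This is \<open>\<eta>(E)\<close> for \<open>set_norm\<close> and \<open>pair_norm\<close>, but
  \<open>\<integral> dg d\<mu> = \<integral> |e\<^sub>J| d\<eta>\<close> for \<open>deg_norm\<close>. For \<open>deg_norm\<close> the property can fail with
  \<open>m = \<eta>(E)\<close> if \<open>\<integral> dg d\<mu> > \<eta>(E)\<close>: let \<open>J = {x, y}\<close> with counting measure, \<open>E = {e}\<close>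
  with \<open>\<eta>(E) = 1\<close>, \<open>e\<^sub>J = J\<close>, \<open>dg = 1\<close>, \<open>\<phi>\<^sub>e{x} = \<phi>\<^sub>e{y} = 1\<close>, and let \<open>{f}\<close> with
  \<open>f x = 1\<close>, \<open>f y = -1\<close> be the only set of the family; then \<open>c p q = 2 * 2 powr (- (1 / q))\<close>,
  which is strictly increasing in \<open>q\<close>.
\<close>

definition decreasing_in_q :: "ennreal \<Rightarrow> (real \<Rightarrow> real \<Rightarrow> ennreal) \<Rightarrow> bool" where
  "decreasing_in_q m c \<longleftrightarrow> (\<forall>p\<ge>1. antimono_on {1..} (\<lambda>q. epowr m (1 / q) * c p q))"

end

theory Submission
  imports Defs
begin

text \<open>
  For \<open>u > 0\<close> put \<open>h(f, u) = \<phi>\<^sub>e{f \<ge> u} + \<phi>\<^sub>e{f \<ge> -u}\<close>, respectively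
  \<open>h(f, u) = \<psi>\<^sub>e({f \<ge> u}, {f \<le> -u})\<close>. The extension of \<open>\<phi>\<^sub>e\<close> or \<open>\<psi>\<^sub>e\<close> at \<open>f\<close> is
  \<open>L(f) = \<integral>\<^sub>0\<^sup>\<infinity> h(f, u) du\<close>, the set norms are built from
  the infimum of the \<open>t\<close> with \<open>h(f, \<cdot>) = 0\<close> on \<open>[t, \<infinity>)\<close>, and
  \<open>h(f\<^sup>t, u\<^sup>t) = h(f, u)\<close>, so that \<open>L(f\<^sup>t) = \<integral> h(f, u) t u\<^sup>t\<^sup>-\<^sup>1 du\<close>. With \<open>0 \<le> h \<le> 2C\<close> and \<open>h(f, \<cdot>) = 0\<close>
  beyond \<open>W\<close> this gives
  \<open>L(f)\<^sup>t \<le> (2C)\<^sup>t\<^sup>-\<^sup>1 L(f\<^sup>t)\<close> and \<open>L(f\<^sup>t) \<le> t W\<^sup>t\<^sup>-\<^sup>1 L(f)\<close>. The first inequality is the lower bound in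
  (ii), which rescales to (i). The upper bound in (ii) is the second inequality followed by
  Hoelder's inequality, where \<open>W\<close> is controlled by either norm: by definition for the set norms, and
  by \<open>W = (\<Sum>x\<in>e\<^sub>J. |f x|\<^sup>r)\<^sup>1\<^sup>/\<^sup>r\<close> for the degree norm. Part (iii) is the monotonicity of power means.
\<close>

section \<open>Extended powers and Hoelder's inequality\<close>

lemma epowr_0 [simp]: "0 < a \<Longrightarrow> epowr 0 a = 0"
  and epowr_top [simp]: "0 < a \<Longrightarrow> epowr top a = top"
  and epowr_one_right [simp]: "epowr x 1 = x"
  and epowr_zero_right [simp]: "epowr x 0 = 1"
  by (auto simp: epowr_def less_top)

lemma epowr_ennreal: "0 \<le> x \<Longrightarrow> 0 < a \<Longrightarrow> epowr (ennreal x) a = ennreal (x powr a)"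
  by (cases "x = 0") (auto simp: epowr_def ennreal_eq_0_iff)

lemma epowr_ennreal_pos: "0 < x \<Longrightarrow> epowr (ennreal x) a = ennreal (x powr a)"
  by (auto simp: epowr_def ennreal_eq_0_iff)

lemma epowr_mono: "0 < a \<Longrightarrow> x \<le> y \<Longrightarrow> epowr x a \<le> epowr y a"
  by (cases x; cases y) (auto simp: epowr_ennreal powr_mono2 top_unique ennreal_leI)

lemma epowr_epowr: "0 < a \<Longrightarrow> 0 < b \<Longrightarrow> epowr (epowr x a) b = epowr x (a * b)"
  by (cases x) (auto simp: epowr_ennreal powr_powr)

lemma epowr_le_iff [simp]: "0 < a \<Longrightarrow> epowr x a \<le> epowr y a \<longleftrightarrow> x \<le> y"
  using epowr_mono[of a x y] epowr_mono[of "1 / a" "epowr x a" "epowr y a"]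
  by (auto simp: epowr_epowr)

lemma epowr_pos_iff [simp]: "0 < a \<Longrightarrow> 0 < epowr x a \<longleftrightarrow> 0 < x"
  using epowr_le_iff[of a x 0] by (auto simp: not_le[symmetric] simp del: epowr_le_iff)

lemma epowr_eq_0_iff [simp]: "0 < a \<Longrightarrow> epowr x a = 0 \<longleftrightarrow> x = 0"
  using epowr_pos_iff[of a x] by (metis zero_less_iff_neq_zero)

lemma epowr_less_top_iff [simp]: "0 < a \<Longrightarrow> epowr x a < top \<longleftrightarrow> x < top"
  using epowr_le_iff[of a top x] by (auto simp: not_le[symmetric] simp del: epowr_le_iff)

lemma epowr_mult: "0 < a \<Longrightarrow> epowr (x * y) a = epowr x a * epowr y a"
proof (cases "x = 0 \<or> y = 0 \<or> x = top \<or> y = top")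
  case True
  assume "0 < a"
  with True epowr_pos_iff[of a] show ?thesis
    by (auto simp: ennreal_mult_top ennreal_top_mult zero_less_iff_neq_zero simp del: epowr_pos_iff)
next
  case False
  assume a: "0 < a"
  obtain u v where "x = ennreal u" "y = ennreal v" "0 \<le> u" "0 \<le> v"
    using False by (metis ennreal_cases)
  with a show ?thesis
    by (simp add: epowr_ennreal ennreal_mult[symmetric] powr_mult)
qed

lemma epowr_inverse: "0 < a \<Longrightarrow> epowr (inverse x) a = inverse (epowr x a)"
proof (cases x)
  case (real r)
  assume "0 < a"
  with real show ?thesis
    by (cases "r = 0") (auto simp: inverse_ennreal epowr_ennreal_pos inverse_powr)
qed simp

lemma epowr_divide: "0 < a \<Longrightarrow> epowr (x / y) a = epowr x a / epowr y a"
  by (simp add: divide_ennreal_def epowr_mult epowr_inverse)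

text \<open>Young's inequality is applied to \<open>u\<close> and \<open>v\<close> divided by their
  norms. This needs both integrals positive and finite: if one is zero, the product vanishes almost
  everywhere, and if one is infinite while neither is zero, the right-hand side is
  \<open>top\<close>.\<close>

lemma nn_integral_epowr_Hoelder:
  fixes u v :: "'a \<Rightarrow> real"
  assumes [measurable]: "u \<in> borel_measurable M" "v \<in> borel_measurable M"
    and u0: "\<And>x. x \<in> space M \<Longrightarrow> 0 \<le> u x" and v0: "\<And>x. x \<in> space M \<Longrightarrow> 0 \<le> v x"
    and s: "1 < s" "1 < s'" "1 / s + 1 / s' = 1"
  shows "(\<integral>\<^sup>+x. ennreal (u x * v x) \<partial>M) \<le>
    epowr (\<integral>\<^sup>+x. ennreal (u x powr s) \<partial>M) (1 / s) * epowr (\<integral>\<^sup>+x. ennreal (v x powr s') \<partial>M) (1 / s')"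
    (is "?L \<le> epowr ?A _ * epowr ?B _")
proof -
  have zero: "?L = 0" if "?A = 0 \<or> ?B = 0"
  proof -
    have "AE x in M. u x powr s = 0 \<or> v x powr s' = 0"
      using that by (auto simp: nn_integral_0_iff_AE ennreal_eq_0_iff powr_def elim: eventually_mono)
    then show ?thesis
      by (subst nn_integral_0_iff_AE) (auto elim!: eventually_mono)
  qed
  show ?thesis
  proof (cases "?A = 0 \<or> ?B = 0")
    case True
    with zero show ?thesis by simp
  next
    case False
    show ?thesis
    proof (cases "?A = top \<or> ?B = top")
      case True
      with False s show ?thesis
        by (auto simp: ennreal_mult_top ennreal_top_mult)
    next
      case nt: False
      define A B where "A = enn2real ?A" "B = enn2real ?B"
      then have AB: "?A = ennreal A" "?B = ennreal B" "0 < A" "0 < B"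
        using nt False by (auto simp: less_top enn2real_positive_iff zero_less_iff_neq_zero)
      define a b where "a = A powr (1 / s)" "b = B powr (1 / s')"
      have ab: "0 < a" "0 < b" "a powr s = A" "b powr s' = B"
        using AB s by (auto simp: a_b_def powr_powr)
      \<comment> \<open>After normalisation the two terms of Young's inequality integrate to
        \<open>c * A = 1 / s\<close> and \<open>d * B = 1 / s'\<close>, which add up to one;
        \<open>k\<close> undoes the normalisation.\<close>
      define c d k where "c = 1 / (A * s)" "d = 1 / (B * s')" "k = a * b"
      have cdk: "0 \<le> c" "0 \<le> d" "0 \<le> k" "c * A + d * B = 1"
        using AB ab s by (auto simp: c_d_k_def)
      have "?L \<le> (\<integral>\<^sup>+x. ennreal k *
          (ennreal c * ennreal (u x powr s) + ennreal d * ennreal (v x powr s')) \<partial>M)"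
      proof (rule nn_integral_mono)
        fix x assume x: "x \<in> space M"
        have "(u x / a) * (v x / b) \<le> (u x / a) powr s / s + (v x / b) powr s' / s'"
          using s ab u0[OF x] v0[OF x] by (intro Youngs_inequality) auto
        also have "\<dots> = c * (u x powr s) + d * (v x powr s')"
          using ab u0[OF x] v0[OF x] by (simp add: powr_divide c_d_k_def)
        finally have "u x * v x \<le> k * (c * (u x powr s) + d * (v x powr s'))"
          using ab by (simp add: c_d_k_def field_simps)
        then have "ennreal (u x * v x) \<le> ennreal (k * (c * (u x powr s) + d * (v x powr s')))"
          by (rule ennreal_leI)
        also have "\<dots> = ennreal k * (ennreal c * ennreal (u x powr s) + ennreal d * ennreal (v x powr s'))"
          using cdk by (simp add: ennreal_mult ennreal_plus)
        finally show "ennreal (u x * v x) \<le> \<dots>" .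
      qed
      also have "\<dots> = ennreal k * (ennreal c * ?A + ennreal d * ?B)"
        by (simp add: nn_integral_cmult nn_integral_add)
      also have "ennreal c * ?A + ennreal d * ?B = ennreal (c * A + d * B)"
        unfolding AB using AB cdk(1-3) by (simp add: ennreal_mult ennreal_plus)
      also have "ennreal k * ennreal (c * A + d * B) = ennreal k"
        by (simp add: cdk)
      also have "\<dots> = epowr ?A (1 / s) * epowr ?B (1 / s')"
        unfolding AB using AB ab by (simp add: epowr_ennreal_pos a_b_def c_d_k_def ennreal_mult)
      finally show ?thesis .
    qed
  qed
qed

section \<open>Transfer of min-max constants\<close>

text \<open>The map from \<open>y\<close> to \<open>k * epowr y a\<close> is an order isomorphism of
  the extended half-line. Moving its inverse to the left leaves \<open>y\<close> bare, so that an
  infimum in its place can be bounded below member by member.\<close>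

lemma ennreal_le_mult_epowr_iff:
  assumes "0 < k" "k < top" "0 < a"
  shows "x \<le> k * epowr y a \<longleftrightarrow> epowr (x / k) (1 / a) \<le> y"
proof -
  have "x \<le> k * epowr y a \<longleftrightarrow> x / k \<le> epowr y a"
  proof
    assume "x \<le> k * epowr y a"
    then show "x / k \<le> epowr y a"
      using assms by (intro divide_le_posI_ennreal) auto
  next
    assume "x / k \<le> epowr y a"
    then have "k * (x / k) \<le> k * epowr y a" by (rule mult_left_mono) simp
    moreover have "k * (x / k) = x"
      using assms by (simp add: ennreal_times_divide mult.commute[of k] mult_divide_eq_ennreal)
    ultimately show "x \<le> k * epowr y a" by simp
  qed
  also have "\<dots> \<longleftrightarrow> epowr (x / k) (1 / a) \<le> epowr (epowr y a) (1 / a)"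
    using assms by simp
  also have "epowr (epowr y a) (1 / a) = y"
    using assms by (simp add: epowr_epowr)
  finally show ?thesis .
qed

text \<open>The image under \<open>m\<close> of a competitor \<open>Y\<close> on the right is a
  competitor on the left, and by \<open>valid\<close> the same functions count in both. The bound on
  quotients thus passes to suprema and then to the infimum. Below, \<open>m\<close> is a Mazur map
  or the identity.\<close>

lemma minimax_transfer:
  assumes closed: "\<And>Y. Y \<in> \<Y> \<Longrightarrow> m ` Y \<in> \<Y>"
    and valid: "\<And>Y f. Y \<in> \<Y> \<Longrightarrow> f \<in> Y \<Longrightarrow>
      0 < N1 (m f) \<and> N1 (m f) < top \<longleftrightarrow> 0 < N2 f \<and> N2 f < top"
    and bound: "\<And>Y f. Y \<in> \<Y> \<Longrightarrow> f \<in> Y \<Longrightarrow> 0 < N2 f \<Longrightarrow> N2 f < top \<Longrightarrow>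
      F1 (m f) / N1 (m f) \<le> k * epowr (F2 f / N2 f) a"
    and k: "0 < k" "k < top" and a: "0 < a"
  shows "minimax \<Y> F1 N1 \<le> k * epowr (minimax \<Y> F2 N2) a"
  unfolding ennreal_le_mult_epowr_iff[OF k a]
proof (subst (2) minimax_def, rule INF_greatest)
  fix Y assume "Y \<in> {Y \<in> \<Y>. \<exists>f\<in>Y. 0 < N2 f \<and> N2 f < top}"
  then have Y: "Y \<in> \<Y>" "\<exists>f\<in>Y. 0 < N2 f \<and> N2 f < top" by auto
  let ?S = "SUP f\<in>{f \<in> Y. 0 < N2 f \<and> N2 f < top}. F2 f / N2 f"
  have "minimax \<Y> F1 N1 \<le> (SUP f\<in>{f \<in> m ` Y. 0 < N1 f \<and> N1 f < top}. F1 f / N1 f)"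
    unfolding minimax_def using Y closed valid[OF Y(1)] by (intro INF_lower) blast
  also have "\<dots> \<le> k * epowr ?S a"
  proof (rule SUP_least)
    fix g assume "g \<in> {f \<in> m ` Y. 0 < N1 f \<and> N1 f < top}"
    then obtain f where f: "f \<in> Y" "g = m f" "0 < N2 f" "N2 f < top"
      using valid[OF Y(1)] by blast
    have "F1 g / N1 g \<le> k * epowr (F2 f / N2 f) a"
      using bound[OF Y(1) f(1,3,4)] f(2) by simp
    also have "\<dots> \<le> k * epowr ?S a"
      using f a by (intro mult_left_mono epowr_mono SUP_upper) auto
    finally show "F1 g / N1 g \<le> k * epowr ?S a" .
  qed
  finally show "epowr (minimax \<Y> F1 N1 / k) (1 / a) \<le> ?S"
    unfolding ennreal_le_mult_epowr_iff[OF k a] .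
qed

section \<open>Norms of nonnegative functions, Hoelder's inequality and power means\<close>

definition lnorm :: "'a measure \<Rightarrow> ('a \<Rightarrow> real) \<Rightarrow> real \<Rightarrow> ennreal" where
  "lnorm M u p = epowr (\<integral>\<^sup>+x. ennreal (u x powr p) \<partial>M) (1 / p)"

lemma lnorm_cong: "(\<And>x. x \<in> space M \<Longrightarrow> u x = v x) \<Longrightarrow> lnorm M u p = lnorm M v p"
  by (simp add: lnorm_def cong: nn_integral_cong)

lemma lnorm_mono:
  assumes "0 < p" "\<And>x. x \<in> space M \<Longrightarrow> 0 \<le> u x" "\<And>x. x \<in> space M \<Longrightarrow> u x \<le> v x"
  shows "lnorm M u p \<le> lnorm M v p"
  unfolding lnorm_def using assms
  by (intro epowr_mono nn_integral_mono ennreal_leI powr_mono2) auto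

lemma lnorm_powr: "0 < t \<Longrightarrow> 0 < p \<Longrightarrow> lnorm M (\<lambda>x. u x powr t) p = epowr (lnorm M u (p * t)) t"
  by (simp add: lnorm_def epowr_epowr powr_powr mult.commute)

lemma lnorm_cmult:
  assumes "0 < p" "0 \<le> c" "u \<in> borel_measurable M" "\<And>x. x \<in> space M \<Longrightarrow> 0 \<le> u x"
  shows "lnorm M (\<lambda>x. c * u x) p = ennreal c * lnorm M u p"
proof -
  have "(\<integral>\<^sup>+x. ennreal ((c * u x) powr p) \<partial>M) = (\<integral>\<^sup>+x. ennreal (c powr p) * ennreal (u x powr p) \<partial>M)"
    using assms by (intro nn_integral_cong) (simp add: powr_mult ennreal_mult)
  also have "\<dots> = ennreal (c powr p) * (\<integral>\<^sup>+x. ennreal (u x powr p) \<partial>M)"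
    using assms by (intro nn_integral_cmult) measurable
  finally show ?thesis
    using assms by (simp add: lnorm_def epowr_mult epowr_ennreal powr_powr)
qed

lemma lnorm_Hoelder:
  assumes [measurable]: "u \<in> borel_measurable M" "v \<in> borel_measurable M"
    and u0: "\<And>x. x \<in> space M \<Longrightarrow> 0 \<le> u x" and v0: "\<And>x. x \<in> space M \<Longrightarrow> 0 \<le> v x"
    and s: "1 < s" "1 < s'" "1 / s + 1 / s' = 1" and p: "0 < p"
  shows "lnorm M (\<lambda>x. u x * v x) p \<le> lnorm M u (p * s) * lnorm M v (p * s')"
proof -
  have "(\<integral>\<^sup>+x. ennreal ((u x * v x) powr p) \<partial>M) = (\<integral>\<^sup>+x. ennreal (u x powr p * v x powr p) \<partial>M)"
    using u0 v0 by (intro nn_integral_cong) (simp add: powr_mult)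
  also have "\<dots> \<le> epowr (\<integral>\<^sup>+x. ennreal ((u x powr p) powr s) \<partial>M) (1 / s) *
      epowr (\<integral>\<^sup>+x. ennreal ((v x powr p) powr s') \<partial>M) (1 / s')"
    using s by (intro nn_integral_epowr_Hoelder) auto
  finally have "lnorm M (\<lambda>x. u x * v x) p \<le> epowr \<dots> (1 / p)"
    unfolding lnorm_def using p by (intro epowr_mono) auto
  also have "\<dots> = lnorm M u (p * s) * lnorm M v (p * s')"
    using p s by (simp add: lnorm_def epowr_mult epowr_epowr powr_powr mult.commute)
  finally show ?thesis .
qed

text \<open>Hoelder's inequality against the constant one, with \<open>s = p' / p\<close>; the norm
  of the constant gives the factor because \<open>1 / (p * s') = 1 / p - 1 / p'\<close>. Allowing
  \<open>m\<close> to exceed the total mass later admits \<open>\<eta>E\<close> for the degree norm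
  if \<open>D \<le> \<eta>E\<close>.\<close>

lemma lnorm_power_mean:
  assumes [measurable]: "u \<in> borel_measurable M" and u0: "\<And>x. x \<in> space M \<Longrightarrow> 0 \<le> u x"
    and m: "emeasure M (space M) \<le> ennreal m" "0 < m" and p: "0 < p" "p \<le> p'"
  shows "lnorm M u p \<le> ennreal (m powr (1 / p - 1 / p')) * lnorm M u p'"
proof (cases "p = p'")
  case True
  then show ?thesis using m by simp
next
  case False
  define s s' where "s = p' / p" "s' = p' / (p' - p)"
  have s: "1 < s" "1 < s'" "1 / s + 1 / s' = 1"
    using False p by (auto simp: s_s'_def field_simps)
  have ps: "p * s = p'" "1 / (p * s') = 1 / p - 1 / p'" "0 < p * s'"
    using False p by (auto simp: s_s'_def field_simps)
  have "lnorm M u p = lnorm M (\<lambda>x. u x * 1) p" by simp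
  also have "\<dots> \<le> lnorm M u (p * s) * lnorm M (\<lambda>_. 1) (p * s')"
    using s p u0 by (intro lnorm_Hoelder) auto
  also have "lnorm M (\<lambda>_. 1) (p * s') = epowr (emeasure M (space M)) (1 / (p * s'))"
    by (simp add: lnorm_def)
  also have "\<dots> \<le> epowr (ennreal m) (1 / (p * s'))"
    by (intro epowr_mono[OF _ m(1)]) (simp only: zero_less_divide_1_iff ps(3))
  also have "\<dots> = ennreal (m powr (1 / p - 1 / p'))"
    unfolding epowr_ennreal_pos[OF m(2)] ps(2) ..
  finally have "lnorm M u p \<le> lnorm M u (p * s) * ennreal (m powr (1 / p - 1 / p'))"
    by (simp add: mult_left_mono)
  then show ?thesis by (simp add: ps mult.commute)
qed

text \<open>The right-hand side is free of \<open>p\<close>, so positivity of the norm is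
  independent of the exponent.\<close>

lemma lnorm_pos_iff:
  assumes "u \<in> borel_measurable M" "0 < p"
  shows "0 < lnorm M u p \<longleftrightarrow> \<not> (AE x in M. u x = 0)"
proof -
  have "(\<integral>\<^sup>+x. ennreal (u x powr p) \<partial>M) = 0 \<longleftrightarrow> (AE x in M. u x = 0)"
    using assms(1) by (subst nn_integral_0_iff_AE) (auto simp: ennreal_eq_0_iff powr_def)
  then show ?thesis
    using assms(2) by (simp add: lnorm_def zero_less_iff_neq_zero del: epowr_pos_iff)
qed

lemma lnorm_less_top:
  assumes "\<And>x. x \<in> space M \<Longrightarrow> 0 \<le> u x \<and> u x \<le> b" "emeasure M (space M) < top" "0 < p"
  shows "lnorm M u p < top"
proof -
  have "(\<integral>\<^sup>+x. ennreal (u x powr p) \<partial>M) \<le> (\<integral>\<^sup>+x. ennreal (b powr p) \<partial>M)"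
    using assms by (intro nn_integral_mono ennreal_leI powr_mono2) auto
  also have "\<dots> < top"
    using assms by (simp add: ennreal_mult_less_top)
  finally show ?thesis using assms(3) by (simp add: lnorm_def)
qed

section \<open>Composition and boundedness of Mazur maps\<close>

lemma mazur_mazur: "0 < s \<Longrightarrow> 0 < t \<Longrightarrow> mazur s (mazur t f) = mazur (s * t) f"
  by (auto simp: mazur_def fun_eq_iff abs_mult powr_mult powr_powr sgn_mult mult.commute sgn_if)

lemma mazur_1 [simp]: "mazur 1 f = f"
  by (auto simp: mazur_def fun_eq_iff sgn_if abs_if)

lemma mazur_Bd:
  assumes "f \<in> Bd J" "0 < t"
  shows "mazur t f \<in> Bd J"
proof -
  obtain b where b: "\<And>x. x \<in> space J \<Longrightarrow> \<bar>f x\<bar> \<le> b" and [measurable]: "f \<in> borel_measurable J"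
    using assms by (auto simp: Bd_def)
  have "\<bar>mazur t f x\<bar> \<le> b powr t" if "x \<in> space J" for x
    using b[OF that] assms(2) by (auto simp: mazur_def abs_mult sgn_if intro: powr_mono2)
  then show ?thesis
    unfolding Bd_def mazur_def by (auto intro!: exI[of _ "b powr t"])
qed

section \<open>Monotonicity from pointwise comparison along Mazur maps\<close>

text \<open>Common input for all four constants. \<open>L f\<close> is the integrand of
  \<open>Phi\<close> or \<open>Psi\<close>, and \<open>V f\<close> that of the norm on its own
  measure space \<open>M\<close>: this is \<open>J\<close> weighted by \<open>dg\<close> for the
  degree norm, and \<open>E\<close> for the set norms. \<open>K\<close> will be
  \<open>2 * C\<close>. In \<open>L_upper\<close>, \<open>W\<close> may depend on \<open>r\<close>
  but not on \<open>t\<close>; it brings the norm over \<open>M\<close> back to \<open>E\<close>,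
  where Hoelder's inequality is used.\<close>

locale mazur_comparison =
  fixes J :: "'j measure" and \<Y> :: "('j \<Rightarrow> real) set set"
    and E :: "'e measure" and M :: "'a measure"
    and L :: "('j \<Rightarrow> real) \<Rightarrow> 'e \<Rightarrow> real" and V :: "('j \<Rightarrow> real) \<Rightarrow> 'a \<Rightarrow> real" and K :: real
  assumes adm: "admissible J \<Y>" and K_nonneg: "0 \<le> K"
    and L_measurable: "f \<in> Bd J \<Longrightarrow> L f \<in> borel_measurable E"
    and L_nonneg: "f \<in> Bd J \<Longrightarrow> e \<in> space E \<Longrightarrow> 0 \<le> L f e"
    and V_measurable: "f \<in> Bd J \<Longrightarrow> V f \<in> borel_measurable M"
    and V_nonneg: "f \<in> Bd J \<Longrightarrow> x \<in> space M \<Longrightarrow> 0 \<le> V f x"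
    and V_bounded: "f \<in> Bd J \<Longrightarrow> \<exists>b. \<forall>x\<in>space M. V f x \<le> b"
    and V_mazur: "f \<in> Bd J \<Longrightarrow> 0 < t \<Longrightarrow> x \<in> space M \<Longrightarrow> V (mazur t f) x = V f x powr t"
    and L_lower: "f \<in> Bd J \<Longrightarrow> 1 < t \<Longrightarrow> e \<in> space E \<Longrightarrow>
      L f e powr t \<le> K powr (t - 1) * L (mazur t f) e"
    and L_upper: "f \<in> Bd J \<Longrightarrow> 1 \<le> r \<Longrightarrow> \<exists>W\<in>borel_measurable E.
      (\<forall>e\<in>space E. 0 \<le> W e \<and> (\<forall>t>1. L (mazur t f) e \<le> t * W e powr (t - 1) * L f e)) \<and>
      lnorm E W r \<le> lnorm M (V f) r"
begin

definition c :: "real \<Rightarrow> real \<Rightarrow> ennreal" where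
  "c p q = minimax \<Y> (\<lambda>f. lnorm E (L f) p) (\<lambda>f. lnorm M (V f) q)"

lemma Y_Bd: "Y \<in> \<Y> \<Longrightarrow> f \<in> Y \<Longrightarrow> f \<in> Bd J"
  using adm by (auto simp: admissible_def)

lemma Y_mazur: "Y \<in> \<Y> \<Longrightarrow> 0 < t \<Longrightarrow> mazur t ` Y \<in> \<Y>"
  using adm by (auto simp: admissible_def)

lemma lnorm_V_mazur:
  assumes "f \<in> Bd J" "0 < t" "0 < q"
  shows "lnorm M (V (mazur t f)) q = epowr (lnorm M (V f) (q * t)) t"
  using assms by (simp add: V_mazur lnorm_powr cong: lnorm_cong)

text \<open>For \<open>g = mazur (1 / t) f\<close>, \<open>L_lower\<close> bounds
  \<open>L g e powr t\<close> by a multiple of \<open>L f e\<close>. Integrating and taking a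
  \<open>t\<close>-th root bounds the quotient, because the norm of \<open>f\<close> is the
  \<open>t\<close>-th power of that of \<open>g\<close>. The bound \<open>k\<close> replaces
  \<open>K\<close>, which may be zero, since \<open>minimax_transfer\<close> asks for a positive
  factor.\<close>

lemma c_lower:
  assumes k: "0 < k" "K \<le> k" and t: "1 < t" and p: "0 < p" and q: "0 < q"
  shows "c (p * t) (q * t) \<le> ennreal (k powr ((t - 1) / t)) * epowr (c p q) (1 / t)"
  unfolding c_def
proof (rule minimax_transfer)
  show "Y \<in> \<Y> \<Longrightarrow> mazur (1 / t) ` Y \<in> \<Y>" for Y
    using t by (intro Y_mazur) auto
  fix Y f assume "Y \<in> \<Y>" "f \<in> Y"
  then have f: "f \<in> Bd J" by (rule Y_Bd)
  define g where "g = mazur (1 / t) f"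
  have g: "g \<in> Bd J" "mazur t g = f"
    using f t by (auto simp: g_def mazur_Bd mazur_mazur)
  have V: "lnorm M (V f) q = epowr (lnorm M (V g) (q * t)) t"
    using lnorm_V_mazur[OF g(1), of t q] g t q by simp
  then show "0 < lnorm M (V (mazur (1 / t) f)) (q * t) \<and> lnorm M (V (mazur (1 / t) f)) (q * t) < top \<longleftrightarrow>
      0 < lnorm M (V f) q \<and> lnorm M (V f) q < top"
    using t by (simp add: g_def)
  have "epowr (lnorm E (L g) (p * t)) t = lnorm E (\<lambda>e. L g e powr t) p"
    using t p by (simp add: lnorm_powr)
  also have "\<dots> \<le> lnorm E (\<lambda>e. k powr (t - 1) * L f e) p"
  proof (rule lnorm_mono[OF p])
    fix e assume e: "e \<in> space E"
    have "L g e powr t \<le> K powr (t - 1) * L f e"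
      using L_lower[OF g(1) t e] g by simp
    also have "\<dots> \<le> k powr (t - 1) * L f e"
      using k t L_nonneg[OF f e] K_nonneg by (intro mult_right_mono powr_mono2) auto
    finally show "L g e powr t \<le> k powr (t - 1) * L f e" .
  qed simp
  also have "\<dots> = ennreal (k powr (t - 1)) * lnorm E (L f) p"
    using p f by (intro lnorm_cmult) (auto simp: L_measurable L_nonneg)
  finally have "epowr (epowr (lnorm E (L g) (p * t)) t) (1 / t) \<le>
      epowr (ennreal (k powr (t - 1)) * lnorm E (L f) p) (1 / t)"
    using t by (intro epowr_mono) auto
  then have "lnorm E (L g) (p * t) \<le> ennreal (k powr ((t - 1) / t)) * epowr (lnorm E (L f) p) (1 / t)"
    using t k by (simp add: epowr_epowr epowr_mult epowr_ennreal_pos powr_powr)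
  then have "lnorm E (L g) (p * t) / lnorm M (V g) (q * t) \<le>
      ennreal (k powr ((t - 1) / t)) * epowr (lnorm E (L f) p) (1 / t) / lnorm M (V g) (q * t)"
    by (rule divide_right_mono_ennreal)
  also have "lnorm M (V g) (q * t) = epowr (lnorm M (V f) q) (1 / t)"
    using V t by (simp add: epowr_epowr)
  finally show "lnorm E (L (mazur (1 / t) f)) (p * t) / lnorm M (V (mazur (1 / t) f)) (q * t) \<le>
      ennreal (k powr ((t - 1) / t)) * epowr (lnorm E (L f) p / lnorm M (V f) q) (1 / t)"
    using t V by (simp add: epowr_divide ennreal_times_divide g_def epowr_epowr)
qed (use k t in auto)

text \<open>\<open>L_upper\<close> and Hoelder's inequality split off the norm of
  \<open>W e powr (t - 1)\<close>, which is at most \<open>?N\<close> to the power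
  \<open>t - 1\<close>. The norm of \<open>mazur t g\<close> is \<open>?N\<close> to the power
  \<open>t\<close>, so the quotient keeps exactly one factor \<open>inverse ?N\<close>.\<close>

lemma c_upper:
  assumes s: "1 < s" and t: "1 < t" and p: "0 < p" and q: "1 \<le> q"
    and eq: "p * (s / (s - 1)) = q * (t / (t - 1))"
  shows "c p q \<le> ennreal t * c (p * s) (q * t)"
proof -
  \<comment> \<open>The exponent \<open>1\<close> brings the claim into the form of
    \<open>minimax_transfer\<close>.\<close>
  have "c p q \<le> ennreal t * epowr (c (p * s) (q * t)) 1"
    unfolding c_def
  proof (rule minimax_transfer)
    show "Y \<in> \<Y> \<Longrightarrow> mazur t ` Y \<in> \<Y>" for Y
      using t by (intro Y_mazur) auto
    fix Y g assume "Y \<in> \<Y>" "g \<in> Y"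
    then have g: "g \<in> Bd J" by (rule Y_Bd)
    let ?N = "lnorm M (V g) (q * t)"
    have V: "lnorm M (V (mazur t g)) q = epowr ?N t"
      using lnorm_V_mazur[OF g, of t q] t q by simp
    then show "0 < lnorm M (V (mazur t g)) q \<and> lnorm M (V (mazur t g)) q < top \<longleftrightarrow> 0 < ?N \<and> ?N < top"
      using t by simp
    assume N: "0 < ?N" "?N < top"
    then obtain n where n: "?N = ennreal n" "0 < n"
      by (cases ?N) (auto simp: less_top)
    have "1 * 1 \<le> q * t" using q t by (intro mult_mono) auto
    then obtain W where [measurable]: "W \<in> borel_measurable E"
      and W: "\<And>e. e \<in> space E \<Longrightarrow> 0 \<le> W e"
        "\<And>e. e \<in> space E \<Longrightarrow> L (mazur t g) e \<le> t * W e powr (t - 1) * L g e"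
        "lnorm E W (q * t) \<le> ?N"
      using L_upper[OF g, of "q * t"] t by auto
    note [measurable] = L_measurable[OF g]
    define s' where "s' = s / (s - 1)"
    have s': "1 < s'" "1 / s + 1 / s' = 1"
      using s by (auto simp: s'_def field_simps)
    \<comment> \<open>The conjugacy relation is \<open>p * s' = q * (t / (t - 1))\<close>; it is
      chosen so that the norm of \<open>W\<close> appears with the same exponent
      \<open>q * t\<close> as in \<open>?N\<close>.\<close>
    have exps: "p * s' * (t - 1) = q * t" "0 < p * s'"
      using eq s t p by (auto simp: s'_def field_simps)
    have "lnorm E (L (mazur t g)) p \<le> lnorm E (\<lambda>e. t * (L g e * W e powr (t - 1))) p"
      using L_nonneg[OF mazur_Bd[OF g]] t W by (intro lnorm_mono[OF p]) (auto simp: mult_ac)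
    also have "\<dots> = ennreal t * lnorm E (\<lambda>e. L g e * W e powr (t - 1)) p"
      using t L_nonneg[OF g] p by (intro lnorm_cmult) auto
    also have "\<dots> \<le> ennreal t * (lnorm E (L g) (p * s) * lnorm E (\<lambda>e. W e powr (t - 1)) (p * s'))"
      using s s' p L_nonneg[OF g] by (intro mult_left_mono lnorm_Hoelder) auto
    also have "lnorm E (\<lambda>e. W e powr (t - 1)) (p * s') = epowr (lnorm E W (q * t)) (t - 1)"
      using t exps by (simp add: lnorm_powr)
    also have "\<dots> \<le> epowr ?N (t - 1)"
      using W t by (intro epowr_mono) auto
    finally have "lnorm E (L (mazur t g)) p \<le> ennreal t * (lnorm E (L g) (p * s) * epowr ?N (t - 1))"
      by (simp add: mult_left_mono)
    then have "lnorm E (L (mazur t g)) p / lnorm M (V (mazur t g)) q \<le>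
        ennreal t * (lnorm E (L g) (p * s) * epowr ?N (t - 1)) / epowr ?N t"
      unfolding V by (rule divide_right_mono_ennreal)
    also have "\<dots> = ennreal t * (lnorm E (L g) (p * s) * (epowr ?N (t - 1) / epowr ?N t))"
      by (simp add: divide_ennreal_def mult.assoc)
    also have "epowr ?N (t - 1) / epowr ?N t = inverse ?N"
      using n t by (simp add: epowr_ennreal_pos divide_ennreal inverse_ennreal powr_diff inverse_eq_divide)
    finally show "lnorm E (L (mazur t g)) p / lnorm M (V (mazur t g)) q \<le>
        ennreal t * epowr (lnorm E (L g) (p * s) / ?N) 1"
      by (simp add: divide_ennreal_def)
  qed (use t in auto)
  then show ?thesis by simp
qed

text \<open>For \<open>K > 0\<close> this is the \<open>t\<close>-th power of
  \<open>c_lower\<close>. For \<open>K = 0\<close> the factor \<open>epowr 0 (1 - t)\<close> is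
  \<open>top\<close>, so the claim is that \<open>c (p * t) (q * t) = 0\<close> unless
  \<open>c p q = top\<close>; this follows by letting \<open>k\<close> in \<open>c_lower\<close>
  tend to zero.\<close>

lemma c_two_sided_lower:
  assumes t: "1 < t" and p: "0 < p" and q: "0 < q"
  shows "epowr (ennreal K) (1 - t) * epowr (c (p * t) (q * t)) t \<le> c p q"
proof (cases "0 < K")
  case True
  have "epowr (c (p * t) (q * t)) t \<le> epowr (ennreal (K powr ((t - 1) / t)) * epowr (c p q) (1 / t)) t"
    using c_lower[OF True order.refl t p q] t by (intro epowr_mono) auto
  also have "\<dots> = ennreal (K powr (t - 1)) * c p q"
    using t True by (simp add: epowr_mult epowr_epowr epowr_ennreal_pos powr_powr)
  finally have "epowr (ennreal K) (1 - t) * epowr (c (p * t) (q * t)) t \<le>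
      epowr (ennreal K) (1 - t) * (ennreal (K powr (t - 1)) * c p q)"
    by (rule mult_left_mono) simp
  also have "\<dots> = c p q"
    using True by (simp add: epowr_ennreal_pos flip: mult.assoc ennreal_mult powr_add)
  finally show ?thesis .
next
  case False
  show ?thesis
  proof (cases "c p q = top")
    case fin: False
    let ?R = "epowr (c p q) (1 / t)"
    have R: "?R < top" using fin t by (simp add: less_top)
    have "c (p * t) (q * t) \<le> ennreal d" if d: "0 < d" for d
    proof -
      define r where "r = enn2real ?R"
      have r: "?R = ennreal r" "0 \<le> r" using R by (auto simp: r_def)
      \<comment> \<open>Solves \<open>k powr ((t - 1) / t) = d / (r + 1)\<close>; the added
        \<open>1\<close> covers \<open>r = 0\<close> and still leaves
        \<open>d / (r + 1) * r \<le> d\<close>.\<close>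
      define k where "k = (d / (r + 1)) powr (t / (t - 1))"
      have "k powr ((t - 1) / t) = d / (r + 1)"
        using t d r by (simp add: k_def powr_powr)
      moreover have "0 < k" using d r by (simp add: k_def)
      ultimately have "c (p * t) (q * t) \<le> ennreal (d / (r + 1)) * ennreal r"
        using c_lower[OF _ _ t p q, of k] False r by simp
      also have "\<dots> = ennreal (d / (r + 1) * r)"
        using d r by (intro ennreal_mult[symmetric]) auto
      also have "\<dots> \<le> ennreal d"
        using d r by (intro ennreal_leI) (simp add: field_simps)
      finally show ?thesis .
    qed
    then have "c (p * t) (q * t) \<le> 0"
      by - (rule ennreal_le_epsilon, simp)
    then show ?thesis using t by simp
  qed simp
qed

lemma two_sided:
  assumes "2 * C = ennreal K" "1 \<le> p" "1 \<le> q"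
  shows "two_sided_bound C c p q"
  unfolding two_sided_bound_def
proof (intro allI impI)
  fix s t :: real
  assume st: "1 \<le> s" "1 \<le> t" "ennreal p * hoelder_conj s = ennreal q * hoelder_conj t"
  show "epowr (2 * C) (1 - t) * epowr (c (p * t) (q * t)) t \<le> c p q \<and> c p q \<le> ennreal t * c (p * s) (q * t)"
  proof (cases "t = 1 \<or> s = 1")
    case True
    \<comment> \<open>A conjugate is infinite exactly for exponent one, so the relation forces
      \<open>s\<close> and \<open>t\<close> to be one together, and then both bounds are
      trivial.\<close>
    have "ennreal x * hoelder_conj r = top \<longleftrightarrow> r = 1" if "1 \<le> x" for x r
      using that by (simp add: hoelder_conj_def ennreal_mult_eq_top_iff)
    then have "s = 1" "t = 1"
      using True st(3) assms(2,3) by metis+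
    then show ?thesis by simp
  next
    case False
    then have st': "1 < s" "1 < t" using st by auto
    define x y where "x = s / (s - 1)" "y = t / (t - 1)"
    have nonneg: "0 \<le> p" "0 \<le> q" "0 \<le> x" "0 \<le> y"
      using st' assms by (auto simp: x_y_def)
    have "ennreal p * ennreal x = ennreal q * ennreal y"
      using st(3) st' by (simp add: hoelder_conj_def x_y_def)
    then have "ennreal (p * x) = ennreal (q * y)"
      using nonneg by (simp only: ennreal_mult)
    then have eq: "p * (s / (s - 1)) = q * (t / (t - 1))"
      unfolding x_y_def[symmetric] using nonneg by (simp only: ennreal_inj mult_nonneg_nonneg)
    have pq: "0 < p" "0 < q" using assms by auto
    show ?thesis
      unfolding assms(1) using c_two_sided_lower[OF st'(2) pq] c_upper[OF st' pq(1) assms(3) eq] ..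
  qed
qed

text \<open>With \<open>t = r' / r\<close>, the lower bound at the exponents \<open>p * r\<close>
  and \<open>q * r\<close> is divided by \<open>K\<close> and raised to the power
  \<open>r\<close>.\<close>

lemma power_decreasing_c:
  assumes "2 * C = ennreal K"
  shows "power_decreasing C c"
  unfolding power_decreasing_def monotone_on_def
proof (intro allI impI ballI)
  fix p q r r' :: real
  assume A: "1 \<le> p" "1 \<le> q" "r \<in> {1..}" "r' \<in> {1..}" "r \<le> r'"
  show "epowr (1 / (2 * C) * c (p * r') (q * r')) r' \<le> epowr (1 / (2 * C) * c (p * r) (q * r)) r"
  proof (cases "r = r'")
    case False
    define t where "t = r' / r"
    have t: "1 < t" "r' = r * t" using False A by (auto simp: t_def)
    let ?c = "c (p * r) (q * r)" and ?c' = "c (p * r') (q * r')"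
    have low: "epowr (ennreal K) (1 - t) * epowr ?c' t \<le> ?c"
      using c_two_sided_lower[OF t(1), of "p * r" "q * r"] A by (simp add: t mult.assoc)
    have "epowr (1 / ennreal K * ?c') t \<le> 1 / ennreal K * ?c"
    \<comment> \<open>For \<open>K = 0\<close> one has \<open>1 / ennreal K = top\<close>, so both
      sides are \<open>0\<close> or \<open>top\<close>. It remains that \<open>?c = 0\<close> forces
      \<open>?c' = 0\<close>, which \<open>low\<close> gives since
      \<open>epowr 0 (1 - t) = top\<close>.\<close>
    proof (cases "K = 0")
      case True
      show ?thesis
      proof (cases "?c = 0 \<or> ?c' = 0")
        case True
        then have "?c' = 0" 
          using low \<open>K = 0\<close> t by (auto simp: epowr_def[of 0] ennreal_top_mult split: if_splits)
        then show ?thesis using t by simp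
      next
        case False
        then show ?thesis using True t by (simp add: ennreal_top_mult)
      qed
    next
      case False
      then have K: "0 < K" using K_nonneg by simp
      have "epowr (1 / ennreal K * ?c') t = ennreal (1 / K) * (epowr (ennreal K) (1 - t) * epowr ?c' t)"
        using K t by (simp add: epowr_mult epowr_ennreal_pos divide_ennreal ennreal_1[symmetric] powr_divide
            powr_diff mult.assoc[symmetric] del: ennreal_1 flip: ennreal_mult)
      also have "\<dots> \<le> ennreal (1 / K) * ?c"
        using low by (rule mult_left_mono) simp
      also have "ennreal (1 / K) = 1 / ennreal K"
        using K by (simp add: divide_ennreal ennreal_1[symmetric] del: ennreal_1)
      finally show ?thesis .
    qed
    then have "epowr (epowr (1 / ennreal K * ?c') t) r \<le> epowr (1 / ennreal K * ?c) r"
      using A by (intro epowr_mono) auto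
    moreover have "epowr (epowr x t) r = epowr x r'" for x
      using t A by (simp add: epowr_epowr mult.commute)
    ultimately show ?thesis
      unfolding assms by simp
  qed simp
qed

text \<open>The power mean inequality on \<open>E\<close> compares the numerators, the norm staying
  the same; the factor \<open>m powr (1 / p - 1 / p')\<close> is absorbed by the
  normalisation.\<close>

lemma increasing_in_p_c:
  assumes "emeasure E (space E) = ennreal m" "0 < m"
  shows "increasing_in_p (emeasure E (space E)) c"
  unfolding increasing_in_p_def monotone_on_def
proof (intro allI impI ballI)
  fix q p p' :: real
  assume A: "p \<in> {1..}" "p' \<in> {1..}" "p \<le> p'"
  have "c p q \<le> ennreal (m powr (1 / p - 1 / p')) * epowr (c p' q) 1"
    unfolding c_def
  proof (rule minimax_transfer[where m = id])
    fix Y f assume "Y \<in> \<Y>" "f \<in> Y"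
    then have f: "f \<in> Bd J" by (rule Y_Bd)
    have "lnorm E (L f) p \<le> ennreal (m powr (1 / p - 1 / p')) * lnorm E (L f) p'"
      using A assms L_measurable[OF f] L_nonneg[OF f] by (intro lnorm_power_mean) auto
    then have "lnorm E (L f) p / lnorm M (V f) q \<le>
        ennreal (m powr (1 / p - 1 / p')) * lnorm E (L f) p' / lnorm M (V f) q"
      by (rule divide_right_mono_ennreal)
    then show "lnorm E (L (id f)) p / lnorm M (V (id f)) q \<le>
        ennreal (m powr (1 / p - 1 / p')) * epowr (lnorm E (L f) p' / lnorm M (V f) q) 1"
      by (simp add: ennreal_times_divide)
  qed (use assms in auto)
  then have "ennreal (m powr - (1 / p)) * c p q \<le>
      ennreal (m powr - (1 / p)) * (ennreal (m powr (1 / p - 1 / p')) * c p' q)"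
    by (simp add: mult_left_mono)
  also have "\<dots> = ennreal (m powr - (1 / p')) * c p' q"
    by (simp flip: mult.assoc ennreal_mult powr_add)
  finally show "epowr (emeasure E (space E)) (- (1 / p)) * c p q \<le> epowr (emeasure E (space E)) (- (1 / p')) * c p' q"
    unfolding assms(1) epowr_ennreal_pos[OF assms(2)] .
qed

text \<open>Now the power mean inequality on \<open>M\<close> compares the denominators. With
  \<open>m\<close> any finite bound of the total mass, both \<open>D\<close> and
  \<open>\<eta>E\<close> can be inserted for the degree norm.\<close>

lemma decreasing_in_q_c:
  assumes le: "emeasure M (space M) \<le> m" and fin: "m < top"
  shows "decreasing_in_q m c"
proof (cases "m = 0")
  case True
  then show ?thesis by (auto simp: decreasing_in_q_def monotone_on_def)
next
  case False
  obtain d where m: "m = ennreal d" "0 < d"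
    using fin False by (cases m) (auto simp: less_top)
  show ?thesis
    unfolding decreasing_in_q_def monotone_on_def
  proof (intro allI impI ballI)
    fix p q q' :: real
    assume A: "q \<in> {1..}" "q' \<in> {1..}" "q \<le> q'"
    have "c p q' \<le> ennreal (d powr (1 / q - 1 / q')) * epowr (c p q) 1"
      unfolding c_def
    proof (rule minimax_transfer[where m = id])
      fix Y f assume "Y \<in> \<Y>" "f \<in> Y"
      then have f: "f \<in> Bd J" by (rule Y_Bd)
      obtain b where "\<And>x. x \<in> space M \<Longrightarrow> V f x \<le> b"
        using V_bounded[OF f] by auto
      then have "lnorm M (V f) r < top" if "0 < r" for r
        using that V_nonneg[OF f] le fin by (intro lnorm_less_top) auto
      \<comment> \<open>Positivity does not depend on the exponent and every norm of
        \<open>V f\<close> is finite, so \<open>q\<close> and \<open>q'\<close> admit the same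
        functions.\<close>
      then have valid: "0 < lnorm M (V f) q' \<and> lnorm M (V f) q' < top \<longleftrightarrow>
          0 < lnorm M (V f) q \<and> lnorm M (V f) q < top"
        using A V_measurable[OF f] by (simp add: lnorm_pos_iff)
      then show "0 < lnorm M (V (id f)) q' \<and> lnorm M (V (id f)) q' < top \<longleftrightarrow>
          0 < lnorm M (V f) q \<and> lnorm M (V f) q < top"
        by simp
      define k where "k = d powr (1 / q - 1 / q')"
      have k: "0 < k" using m by (simp add: k_def)
      assume N: "0 < lnorm M (V f) q" "lnorm M (V f) q < top"
      obtain a where a: "lnorm M (V f) q = ennreal a" "0 < a"
        using N by (cases "lnorm M (V f) q") auto
      obtain b where b: "lnorm M (V f) q' = ennreal b" "0 < b"
        using N valid by (cases "lnorm M (V f) q'") auto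
      have "lnorm M (V f) q \<le> ennreal k * lnorm M (V f) q'"
        unfolding k_def using A le m V_measurable[OF f] V_nonneg[OF f] by (intro lnorm_power_mean) auto
      then have "a \<le> k * b"
        using b k by (simp add: a ennreal_mult[symmetric])
      then have "inverse b \<le> k * inverse a"
        using a(2) b(2) by (simp add: field_simps)
      then have "inverse (lnorm M (V f) q') \<le> ennreal k * inverse (lnorm M (V f) q)"
        using a b k by (simp add: inverse_ennreal ennreal_leI ennreal_mult[symmetric])
      then have "lnorm E (L f) p * inverse (lnorm M (V f) q') \<le>
          lnorm E (L f) p * (ennreal k * inverse (lnorm M (V f) q))"
        by (intro mult_left_mono) auto
      then show "lnorm E (L (id f)) p / lnorm M (V (id f)) q' \<le>
          ennreal (d powr (1 / q - 1 / q')) * epowr (lnorm E (L f) p / lnorm M (V f) q) 1"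
        by (simp add: divide_ennreal_def mult_ac k_def[symmetric])
    qed (use m in auto)
    then have "ennreal (d powr (1 / q')) * c p q' \<le>
        ennreal (d powr (1 / q')) * (ennreal (d powr (1 / q - 1 / q')) * c p q)"
      by (simp add: mult_left_mono)
    also have "\<dots> = ennreal (d powr (1 / q)) * c p q"
      by (simp flip: mult.assoc ennreal_mult powr_add)
    finally show "epowr m (1 / q') * c p q' \<le> epowr m (1 / q) * c p q"
      unfolding m(1) epowr_ennreal_pos[OF m(2)] .
  qed
qed

end

section \<open>Integrals of level profiles\<close>

lemma set_integrable_bounded_support:
  fixes f :: "real \<Rightarrow> real"
  assumes [measurable]: "f \<in> borel_measurable borel"
    and "\<And>u. 0 < u \<Longrightarrow> \<bar>f u\<bar> \<le> c" "\<And>u. b < u \<Longrightarrow> f u = 0"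
  shows "set_integrable lborel {0<..} f"
  unfolding set_integrable_def
proof (rule Bochner_Integration.integrable_bound)
  show "integrable lborel (\<lambda>u. c * indicat_real {0<..b} u)"
    by (cases "0 \<le> b") (auto simp: integrable_indicator_iff)
  show "AE u in lborel. norm (indicat_real {0<..} u *\<^sub>R f u) \<le> norm (c * indicat_real {0<..b} u)"
    using assms(2,3) by (intro AE_I2) (force simp: indicator_def split: if_splits)
qed simp

text \<open>Substitution \<open>s = u powr t\<close>, where \<open>scale\<close> determines
  \<open>h'\<close> on the positive half-line. Boundedness and bounded support of \<open>h\<close>
  provide the integrability.\<close>

lemma set_integral_powr_substitution:
  fixes h h' :: "real \<Rightarrow> real"
  assumes [measurable]: "h \<in> borel_measurable borel" "h' \<in> borel_measurable borel"
    and bound: "\<And>u. 0 < u \<Longrightarrow> \<bar>h u\<bar> \<le> c" and zero: "\<And>u. b < u \<Longrightarrow> h u = 0" and b: "0 \<le> b"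
    and scale: "\<And>u. 0 < u \<Longrightarrow> h' (u powr t) = h u" and t: "1 < t"
  shows "set_integrable lborel {0<..} (\<lambda>u. h u * (t * u powr (t - 1)))"
    and "(LBINT s:{0<..}. h' s) = (LBINT u:{0<..}. h u * (t * u powr (t - 1)))"
proof -
  have h': "h' s = h (s powr (1 / t))" if "0 < s" for s
    using scale[of "s powr (1 / t)"] that t by (simp add: powr_powr)
  have zero': "h' s = 0" if "b powr t < s" for s
  proof -
    have "0 \<le> b powr t" by simp
    then have s: "0 < s" using that by linarith
    have "(b powr t) powr (1 / t) < s powr (1 / t)"
      using that t by (intro powr_less_mono2) auto
    then show ?thesis using h'[OF s] zero t b by (simp add: powr_powr)
  qed
  \<comment> \<open>The odd extension of the power has a two-sided derivative also at the endpoint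
    \<open>0\<close>, as the substitution rule on the closed interval asks; it is \<open>0\<close>
    there because \<open>t > 1\<close>.\<close>
  define g where "g = (\<lambda>u::real. sgn u * \<bar>u\<bar> powr t)"
  define g' where "g' = (\<lambda>u::real. t * \<bar>u\<bar> powr (t - 1))"
  have deriv: "(g has_real_derivative g' u) (at u)" if "0 \<le> u" for u
  proof (cases "u = 0")
    case True
    have "(\<lambda>y. \<bar>y\<bar> powr (t - 1)) \<midarrow>0\<rightarrow> \<bar>0::real\<bar> powr (t - 1)"
      using t by (intro tendsto_intros) auto
    moreover have "\<forall>\<^sub>F y in at 0. \<bar>y\<bar> powr (t - 1) = (g y - g 0) / (y - 0)"
      unfolding eventually_at_filter
      by (rule always_eventually) (auto simp: g_def sgn_if powr_diff abs_if)
    ultimately have "((\<lambda>y. (g y - g 0) / (y - 0)) \<longlongrightarrow> \<bar>0::real\<bar> powr (t - 1)) (at 0)"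
      by (rule Lim_transform_eventually)
    then show ?thesis
      using t True by (simp add: has_field_derivative_iff g'_def)
  next
    case False
    then have u: "0 < u" using that by simp
    have "((\<lambda>u. u powr t) has_real_derivative g' u) (at u)"
      using u by (auto intro!: derivative_eq_intros simp: g'_def)
    then show ?thesis
    proof (rule has_field_derivative_transform_within_open[where S = "{0<..}"])
      show "\<And>x. x \<in> {0<..} \<Longrightarrow> x powr t = g x" by (simp add: g_def)
    qed (use u in auto)
  qed
  have gb: "g 0 = 0" "g b = b powr t" using b by (auto simp: g_def sgn_if)
  have cont: "continuous_on {0..b} g'"
    unfolding g'_def using t by (intro continuous_on_mult continuous_on_powr' continuous_intros) auto
  have int': "set_integrable lborel {0<..} h'"
  proof (rule set_integrable_bounded_support)
    show "\<bar>h' u\<bar> \<le> c" if "0 < u" for u using bound[of "u powr (1 / t)"] h'[OF that] that by simp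
    show "h' u = 0" if "b powr t < u" for u by (rule zero'[OF that])
  qed simp
  then have "set_integrable lborel {0..b powr t} h'"
  proof -
    have "set_integrable lborel ({0} \<union> {0<..}) h'"
      using int' by (intro set_integrable_Un) auto
    then show ?thesis by (rule set_integrable_subset) auto
  qed
  then have set_int: "set_integrable lborel {g 0..g b} h'" by (simp add: gb)
  show "set_integrable lborel {0<..} (\<lambda>u. h u * (t * u powr (t - 1)))"
  proof (rule set_integrable_bounded_support)
    show "\<bar>h u * (t * u powr (t - 1))\<bar> \<le> c * (t * b powr (t - 1))" if u: "0 < u" for u
    proof (cases "u \<le> b")
      case True
      then show ?thesis
        unfolding abs_mult using bound[OF u] u t by (intro mult_mono) (auto intro: order_trans[OF abs_ge_zero] powr_mono2)
    next
      case False
      then show ?thesis using zero[of u] bound[OF u] t by (auto intro!: mult_nonneg_nonneg)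
    qed
  qed (use zero in auto)
  have "(LBINT s:{0<..}. h' s) = (LBINT s. h' s * indicator {g 0..g b} s)"
    unfolding set_lebesgue_integral_def gb
  proof (rule integral_cong_AE)
    have "AE s in lborel. s \<noteq> (0::real)" by (rule AE_lborel_singleton)
    then show "AE s in lborel. indicat_real {0<..} s *\<^sub>R h' s = h' s * indicator {0..b powr t} s"
    proof (rule eventually_mono)
      fix s :: real assume "s \<noteq> 0"
      then show "indicat_real {0<..} s *\<^sub>R h' s = h' s * indicator {0..b powr t} s"
        using zero'[of s] by (auto simp: indicator_def)
    qed
  qed auto
  also have "\<dots> = (LBINT u. h' (g u) * g' u * indicator {0..b} u)"
    using t b cont deriv set_int by (intro integral_substitution(2)) (auto simp: g'_def)
  also have "\<dots> = (LBINT u:{0<..}. h u * (t * u powr (t - 1)))"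
    unfolding set_lebesgue_integral_def
  proof (rule Bochner_Integration.integral_cong[OF refl])
    fix u :: real
    have "h' (g u) = h u" if "0 < u" using scale[OF that] that by (simp add: g_def)
    moreover have "g' 0 = 0" by (simp add: g'_def)
    ultimately show "h' (g u) * g' u * indicator {0..b} u = indicat_real {0<..} u *\<^sub>R (h u * (t * u powr (t - 1)))"
      using zero[of u] by (cases "u = 0") (auto simp: indicator_def g'_def)
  qed
  finally show "(LBINT s:{0<..}. h' s) = (LBINT u:{0<..}. h u * (t * u powr (t - 1)))" .
qed

text \<open>The weight \<open>t * u powr (t - 1)\<close> increases with \<open>u\<close>, so
  wherever \<open>h\<close> is nonzero it is at most its value at \<open>w\<close>.\<close>

lemma set_integral_weight_upper:
  fixes h :: "real \<Rightarrow> real"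
  assumes "set_integrable lborel {0<..} h" "set_integrable lborel {0<..} (\<lambda>u. h u * (t * u powr (t - 1)))"
    and nonneg: "\<And>u. 0 < u \<Longrightarrow> 0 \<le> h u" and zero: "\<And>u. w < u \<Longrightarrow> h u = 0" and w: "0 \<le> w" and t: "1 < t"
  shows "(LBINT u:{0<..}. h u * (t * u powr (t - 1))) \<le> t * w powr (t - 1) * (LBINT u:{0<..}. h u)"
proof -
  have "(LBINT u:{0<..}. h u * (t * u powr (t - 1))) \<le> (LBINT u:{0<..}. t * w powr (t - 1) * h u)"
  proof (rule set_integral_mono)
    show "h u * (t * u powr (t - 1)) \<le> t * w powr (t - 1) * h u" if "u \<in> {0<..}" for u
    proof (cases "u \<le> w")
      case True
      then have "t * u powr (t - 1) \<le> t * w powr (t - 1)"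
        using that t by (intro mult_left_mono powr_mono2) auto
      then have "t * u powr (t - 1) * h u \<le> t * w powr (t - 1) * h u"
        using nonneg[of u] that by (intro mult_right_mono) auto
      then show ?thesis by (simp add: mult.commute)
    qed (use zero in auto)
  qed (use assms in \<open>auto intro: set_integrable_mult_right\<close>)
  then show ?thesis by simp
qed

text \<open>
  Among all \<open>h\<close> with \<open>0 \<le> h \<le> c\<close> and given integral \<open>A\<close>, the weighted integral is minimal for
  \<open>c\<close> times the indicator of \<open>[0, A / c]\<close>.
\<close>

lemma set_integral_weight_lower:
  fixes h :: "real \<Rightarrow> real"
  assumes int: "set_integrable lborel {0<..} h" "set_integrable lborel {0<..} (\<lambda>u. h u * (t * u powr (t - 1)))"
    and bound: "\<And>u. 0 < u \<Longrightarrow> 0 \<le> h u \<and> h u \<le> c" and t: "1 < t" and c: "0 \<le> c"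
  shows "(LBINT u:{0<..}. h u) powr t \<le> c powr (t - 1) * (LBINT u:{0<..}. h u * (t * u powr (t - 1)))"
proof -
  define A where "A = (LBINT u:{0<..}. h u)"
  define B where "B = (LBINT u:{0<..}. h u * (t * u powr (t - 1)))"
  have A0: "0 \<le> A"
    unfolding A_def set_lebesgue_integral_def using bound
    by (intro Bochner_Integration.integral_nonneg) (auto simp: indicator_def)
  show ?thesis
  proof (cases "c = 0")
    case True
    have "A = 0"
      unfolding A_def using bound True by (intro set_lebesgue_integral_cong[of _ _ _ "\<lambda>_. 0", simplified]) force+
    then show ?thesis unfolding A_def[symmetric] by (simp add: True)
  next
    case False
    with c have c: "0 < c" by simp
    \<comment> \<open>End of the extremal profile: \<open>c\<close> times the indicator
      \<open>i\<close> of \<open>{..a}\<close> has the same integral \<open>A\<close> over the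
      half-line as \<open>h\<close>.\<close>
    define a where "a = A / c"
    have a: "0 \<le> a" "A = c * a" using A0 c by (auto simp: a_def)
    define i where "i = indicat_real {..a}"
    have i_int: "set_integrable lborel {0<..} i"
      unfolding i_def by (rule set_integrable_bounded_support[where c = 1 and b = a]) (auto simp: indicator_def)
    have i1: "(LBINT u:{0<..}. indicat_real {..r} u) = r" if "0 \<le> r" for r
    proof -
      have "(LBINT u:{0<..}. indicat_real {..r} u) = (LBINT u. indicat_real {0<..r} u)"
        unfolding set_lebesgue_integral_def by (rule Bochner_Integration.integral_cong) (auto simp: indicator_def)
      also have "\<dots> = r" using that by simp
      finally show ?thesis .
    qed
    have scale: "indicat_real {..a powr t} (u powr t) = indicat_real {..a} u" if "0 < u" for u
      using that a t powr_less_mono2[of t a u] powr_mono2[of t u a] by (auto simp: indicator_def not_le)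
    \<comment> \<open>The weighted integral of \<open>i\<close> is the length of
      \<open>{0<..a powr t}\<close>, by the substitution that carries \<open>{..a}\<close> to
      \<open>{..a powr t}\<close>.\<close>
    have it: "set_integrable lborel {0<..} (\<lambda>u. i u * (t * u powr (t - 1)))"
      "(LBINT u:{0<..}. i u * (t * u powr (t - 1))) = a powr t"
    proof -
      have *: "indicat_real {..a} \<in> borel_measurable borel" "indicat_real {..a powr t} \<in> borel_measurable borel"
        "\<And>u. 0 < u \<Longrightarrow> \<bar>indicat_real {..a} u\<bar> \<le> 1" "\<And>u. a < u \<Longrightarrow> indicat_real {..a} u = 0"
        by (auto simp: indicator_def)
      show "set_integrable lborel {0<..} (\<lambda>u. i u * (t * u powr (t - 1)))"
        unfolding i_def by (rule set_integral_powr_substitution(1)[OF * a(1) scale t])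
      show "(LBINT u:{0<..}. i u * (t * u powr (t - 1))) = a powr t"
        unfolding i_def using set_integral_powr_substitution(2)[OF * a(1) scale t] by (simp add: i1)
    qed
    \<comment> \<open>The weight at \<open>a\<close>. On each side of \<open>a\<close>,
      \<open>h u - c * i u\<close> and the weight minus \<open>?k\<close> never have opposite signs,
      so their product is nonnegative; in its integral the terms with \<open>?k\<close> cancel by
      the choice of \<open>a\<close>.\<close>
    let ?k = "t * a powr (t - 1)"
    have "(LBINT u:{0<..}. ?k * h u + c * (i u * (t * u powr (t - 1)))) \<le>
        (LBINT u:{0<..}. h u * (t * u powr (t - 1)) + c * ?k * i u)"
    proof (rule set_integral_mono)
      show "?k * h u + c * (i u * (t * u powr (t - 1))) \<le> h u * (t * u powr (t - 1)) + c * ?k * i u"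
        if "u \<in> {0<..}" for u
      proof (cases "u \<le> a")
        case True
        have "0 \<le> (c - h u) * (t * a powr (t - 1) - t * u powr (t - 1))"
          using that True bound[of u] t by (intro mult_nonneg_nonneg) (auto intro!: powr_mono2)
        then show ?thesis using True by (simp add: i_def algebra_simps)
      next
        case False
        have "0 \<le> h u * (t * u powr (t - 1) - t * a powr (t - 1))"
          using that False bound[of u] t a by (intro mult_nonneg_nonneg) (auto intro!: powr_mono2)
        then show ?thesis using False by (simp add: i_def algebra_simps)
      qed
    qed (use int i_int it in \<open>auto intro!: set_integral_add set_integrable_mult_right\<close>)
    moreover have "(LBINT u:{0<..}. ?k * h u + c * (i u * (t * u powr (t - 1)))) = ?k * A + c * a powr t"
      using int it by (subst set_integral_add) (auto simp: A_def intro!: set_integrable_mult_right)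
    moreover have "(LBINT u:{0<..}. h u * (t * u powr (t - 1)) + c * ?k * i u) = B + c * ?k * a"
      using int i_int i1[OF a(1)] by (subst set_integral_add) (auto simp: B_def i_def intro!: set_integrable_mult_right)
    ultimately have "c * a powr t \<le> B" by (simp add: a)
    then have "c powr (t - 1) * (c * a powr t) \<le> c powr (t - 1) * B"
      by (rule mult_left_mono) simp
    also have "c powr (t - 1) * (c * a powr t) = A powr t"
      using a c t by (simp add: powr_mult powr_diff)
    finally show ?thesis by (simp add: A_def B_def)
  qed
qed

section \<open>Radius beyond which a profile vanishes\<close>

text \<open>Common form of \<open>abs_set\<close> and \<open>abs_pair\<close>, with \<open>h\<close>
  the level profile at a fixed \<open>e\<close>.\<close>

definition vanishing_radius :: "(real \<Rightarrow> real) \<Rightarrow> real" where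
  "vanishing_radius h = Inf {t. t > 0 \<and> (\<forall>s\<ge>t. h s = 0)}"

text \<open>Each \<open>b + d\<close> with \<open>d > 0\<close> lies in the set under the infimum,
  whereas \<open>b\<close> itself may be zero or have \<open>h b \<noteq> 0\<close>.\<close>

lemma vanishing_radius_le:
  assumes "0 \<le> b" "\<And>u. b < u \<Longrightarrow> h u = 0"
  shows "vanishing_radius h \<le> b"
proof (rule field_le_epsilon)
  fix d :: real assume "0 < d"
  then show "vanishing_radius h \<le> b + d"
    unfolding vanishing_radius_def using assms by (intro cInf_lower bdd_belowI[of _ 0]) auto
qed

text \<open>The assumption makes the set under the infimum nonempty. The infimum need not be
  attained, but the set is closed upwards, so \<open>h\<close> vanishes strictly above it.\<close>

lemma
  assumes "\<And>u. b < u \<Longrightarrow> h u = 0"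
  shows vanishing_radius_nonneg: "0 \<le> vanishing_radius h"
    and vanishing_radius_zero: "vanishing_radius h < u \<Longrightarrow> h u = 0"
proof -
  let ?T = "{t. t > 0 \<and> (\<forall>s\<ge>t. h s = 0)}"
  have "\<bar>b\<bar> + 1 \<in> ?T" using assms by auto
  then have ne: "?T \<noteq> {}" by blast
  show "0 \<le> vanishing_radius h"
    unfolding vanishing_radius_def by (rule cInf_greatest[OF ne]) auto
  assume "vanishing_radius h < u"
  then obtain t where "t \<in> ?T" "t < u"
    unfolding vanishing_radius_def using cInf_lessD[OF ne] by blast
  then show "h u = 0" by auto
qed

text \<open>Stated one-sidedly, so that the reverse inequality follows by exchanging the profiles
  and replacing \<open>t\<close> by \<open>1 / t\<close>.\<close>

lemma vanishing_radius_scale_le: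
  assumes "\<And>u. b < u \<Longrightarrow> h u = 0" "\<And>u. 0 < u \<Longrightarrow> h' (u powr t) = h u" "0 < t"
  shows "vanishing_radius h' \<le> vanishing_radius h powr t"
proof (rule vanishing_radius_le)
  fix u assume u: "vanishing_radius h powr t < u"
  have nonneg: "0 \<le> vanishing_radius h" using assms(1) by (rule vanishing_radius_nonneg)
  have "0 \<le> vanishing_radius h powr t" by simp
  then have "0 < u" using u by linarith
  have "(vanishing_radius h powr t) powr (1 / t) < u powr (1 / t)"
    using u assms(3) by (intro powr_less_mono2) auto
  then have "h (u powr (1 / t)) = 0"
    using nonneg assms(3) by (intro vanishing_radius_zero[OF assms(1)]) (auto simp: powr_powr)
  then show "h' u = 0"
    using assms(2)[of "u powr (1 / t)"] assms(3) \<open>0 < u\<close> by (simp add: powr_powr)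
qed simp

lemma vanishing_radius_scale:
  assumes "\<And>u. b < u \<Longrightarrow> h u = 0" "\<And>u. b' < u \<Longrightarrow> h' u = 0"
    "\<And>u. 0 < u \<Longrightarrow> h' (u powr t) = h u" "0 < t"
  shows "vanishing_radius h' = vanishing_radius h powr t"
proof (rule antisym)
  show "vanishing_radius h' \<le> vanishing_radius h powr t"
    using assms(1,3,4) by (rule vanishing_radius_scale_le)
  have "h (u powr (1 / t)) = h' u" if "0 < u" for u
    using assms(3)[of "u powr (1 / t)"] assms(4) that by (simp add: powr_powr)
  then have "vanishing_radius h \<le> vanishing_radius h' powr (1 / t)"
    using assms(2,4) by (intro vanishing_radius_scale_le) auto
  then have "vanishing_radius h powr t \<le> (vanishing_radius h' powr (1 / t)) powr t"
    using vanishing_radius_nonneg[OF assms(1)] assms(4) by (intro powr_mono2) auto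
  then show "vanishing_radius h powr t \<le> vanishing_radius h'"
    using vanishing_radius_nonneg[OF assms(2)] assms(4) by (simp add: powr_powr)
qed

section \<open>Degree norm and radius norm\<close>

lemma minimax_cong:
  assumes "\<And>Y f. Y \<in> \<Y> \<Longrightarrow> f \<in> Y \<Longrightarrow> F f = F' f" "\<And>Y f. Y \<in> \<Y> \<Longrightarrow> f \<in> Y \<Longrightarrow> N f = N' f"
  shows "minimax \<Y> F N = minimax \<Y> F' N'"
proof -
  have "{Y \<in> \<Y>. \<exists>f\<in>Y. 0 < N f \<and> N f < top} = {Y \<in> \<Y>. \<exists>f\<in>Y. 0 < N' f \<and> N' f < top}"
    using assms(2) by force
  moreover have "(SUP f\<in>{f \<in> Y. 0 < N f \<and> N f < top}. F f / N f) =
      (SUP f\<in>{f \<in> Y. 0 < N' f \<and> N' f < top}. F' f / N' f)" if "Y \<in> \<Y>" for Y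
    using assms(1)[OF that] assms(2)[OF that] by (intro SUP_cong) auto
  ultimately show ?thesis
    unfolding minimax_def by (intro INF_cong) auto
qed

text \<open>What set functions and set-pair functions share. \<open>H f e\<close> is the profile
  whose integral is the extension; \<open>H_zero\<close> is the form in which concentration on
  \<open>eJ e\<close> enters, and \<open>H_mazur\<close> says that Mazur maps only relabel
  levels.\<close>

locale level_profile =
  fixes J :: "'j measure" and E :: "'e measure" and eJ :: "'e \<Rightarrow> 'j set" and dg :: "'j \<Rightarrow> real"
    and \<Y> :: "('j \<Rightarrow> real) set set" and L :: "('j \<Rightarrow> real) \<Rightarrow> 'e \<Rightarrow> real"
    and H :: "('j \<Rightarrow> real) \<Rightarrow> 'e \<Rightarrow> real \<Rightarrow> real" and K :: real
  assumes degree: "degree_related J E eJ dg" and adm: "admissible J \<Y>" and K_nonneg: "0 \<le> K"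
    and H_measurable: "f \<in> Bd J \<Longrightarrow> e \<in> space E \<Longrightarrow> H f e \<in> borel_measurable borel"
    and H_bounds: "f \<in> Bd J \<Longrightarrow> e \<in> space E \<Longrightarrow> 0 < u \<Longrightarrow> 0 \<le> H f e u \<and> H f e u \<le> K"
    and H_zero: "f \<in> Bd J \<Longrightarrow> e \<in> space E \<Longrightarrow> 0 < u \<Longrightarrow> \<forall>x\<in>eJ e. \<bar>f x\<bar> < u \<Longrightarrow> H f e u = 0"
    and H_mazur: "f \<in> Bd J \<Longrightarrow> e \<in> space E \<Longrightarrow> 0 < t \<Longrightarrow> 0 < u \<Longrightarrow> H (mazur t f) e (u powr t) = H f e u"
    and L_eq: "f \<in> Bd J \<Longrightarrow> e \<in> space E \<Longrightarrow> L f e = (LBINT u:{0<..}. H f e u)"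
    and L_measurable: "f \<in> Bd J \<Longrightarrow> L f \<in> borel_measurable E"
begin

lemma eJ: "e \<in> space E \<Longrightarrow> finite (eJ e)" "e \<in> space E \<Longrightarrow> eJ e \<subseteq> space J"
  using degree by (auto simp: degree_related_def finitely_related_def)

lemma
  shows dg_measurable: "dg \<in> borel_measurable J" and dg_nonneg: "x \<in> space J \<Longrightarrow> 0 \<le> dg x"
    and sum_measurable: "g \<in> Bd J \<Longrightarrow> (\<lambda>e. \<Sum>x\<in>eJ e. g x) \<in> borel_measurable E"
    and sum_integral: "g \<in> Bd J \<Longrightarrow> (\<And>x. x \<in> space J \<Longrightarrow> 0 \<le> g x) \<Longrightarrow>
      (\<integral>\<^sup>+e. ennreal (\<Sum>x\<in>eJ e. g x) \<partial>E) = (\<integral>\<^sup>+x. ennreal (dg x * g x) \<partial>J)"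
  using degree by (auto simp: degree_related_def is_degree_function_def)

lemma Bd_bound:
  assumes "f \<in> Bd J"
  obtains b where "0 \<le> b" "\<forall>x\<in>space J. \<bar>f x\<bar> \<le> b"
proof -
  obtain b where "\<forall>x\<in>space J. \<bar>f x\<bar> \<le> b" using assms by (auto simp: Bd_def)
  then show thesis by (intro that[of "\<bar>b\<bar>"]) force+
qed

lemma H_eventually_zero:
  assumes "0 \<le> b" "\<forall>x\<in>space J. \<bar>f x\<bar> \<le> b" "f \<in> Bd J" "e \<in> space E" "b < u"
  shows "H f e u = 0"
  using assms eJ[OF assms(4)] by (intro H_zero) fastforce+

lemma L_nonneg: "f \<in> Bd J \<Longrightarrow> e \<in> space E \<Longrightarrow> 0 \<le> L f e"
  using H_bounds[of f e]
  by (auto simp: L_eq set_lebesgue_integral_def indicator_def intro!: Bochner_Integration.integral_nonneg)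

text \<open>By \<open>H_mazur\<close> and substitution, \<open>L (mazur t f) e\<close> is the
  integral of \<open>H f e\<close> against the weight \<open>t * u powr (t - 1)\<close>, to which
  the two weight inequalities apply.\<close>

lemma
  assumes f: "f \<in> Bd J" and e: "e \<in> space E" and t: "1 < t"
  shows L_mazur_lower: "L f e powr t \<le> K powr (t - 1) * L (mazur t f) e"
    and L_mazur_upper: "0 \<le> w \<Longrightarrow> (\<And>u. w < u \<Longrightarrow> H f e u = 0) \<Longrightarrow>
      L (mazur t f) e \<le> t * w powr (t - 1) * L f e"
proof -
  have t0: "0 < t" using t by simp
  have g: "mazur t f \<in> Bd J" using mazur_Bd[OF f t0] .
  obtain b where b: "0 \<le> b" "\<forall>x\<in>space J. \<bar>f x\<bar> \<le> b"
    using Bd_bound[OF f] by blast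
  have zero: "H f e u = 0" if "b < u" for u
    using H_eventually_zero[OF b f e that] .
  have bound: "\<bar>H f e u\<bar> \<le> K" if "0 < u" for u
    using H_bounds[OF f e that] by auto
  note [measurable] = H_measurable[OF f e] H_measurable[OF g e]
  have int: "set_integrable lborel {0<..} (H f e)"
    by (rule set_integrable_bounded_support) (use bound zero in auto)
  note sub = set_integral_powr_substitution[OF H_measurable[OF f e] H_measurable[OF g e] bound zero b(1)
      H_mazur[OF f e t0] t]
  have Lg: "L (mazur t f) e = (LBINT u:{0<..}. H f e u * (t * u powr (t - 1)))"
    unfolding L_eq[OF g e] by (rule sub(2))
  show "L f e powr t \<le> K powr (t - 1) * L (mazur t f) e"
    unfolding L_eq[OF f e] Lg
    by (rule set_integral_weight_lower[OF int sub(1) H_bounds[OF f e] t K_nonneg])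
  assume w: "0 \<le> w" "\<And>u. w < u \<Longrightarrow> H f e u = 0"
  show "L (mazur t f) e \<le> t * w powr (t - 1) * L f e"
    unfolding L_eq[OF f e] Lg
    by (rule set_integral_weight_upper[OF int sub(1) _ w(2,1) t]) (use H_bounds[OF f e] in auto)
qed

text \<open>Absorbing \<open>dg\<close> into the measure makes the degree norm an instance of
  \<open>lnorm\<close>.\<close>

lemma lnorm_density:
  assumes "f \<in> Bd J"
  shows "lnorm (density J (\<lambda>x. ennreal (dg x))) (\<lambda>x. \<bar>f x\<bar>) q = deg_norm J dg q f"
proof -
  have [measurable]: "f \<in> borel_measurable J" "dg \<in> borel_measurable J"
    using assms dg_measurable by (auto simp: Bd_def)
  have "(\<integral>\<^sup>+x. ennreal (\<bar>f x\<bar> powr q) \<partial>density J (\<lambda>x. ennreal (dg x))) =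
      (\<integral>\<^sup>+x. ennreal (dg x * \<bar>f x\<bar> powr q) \<partial>J)"
    by (subst nn_integral_density) (auto intro!: nn_integral_cong simp: ennreal_mult dg_nonneg)
  then show ?thesis by (simp add: lnorm_def deg_norm_def)
qed

text \<open>\<open>W e\<close> is the \<open>r\<close>-norm of \<open>f\<close> restricted to
  \<open>eJ e\<close>. It dominates \<open>\<bar>f x\<bar>\<close> on \<open>eJ e\<close>, hence
  bounds the support of the profile by \<open>H_zero\<close>; and the degree identity for
  \<open>\<bar>f x\<bar> powr r\<close> shows that its norm over \<open>E\<close> equals the degree
  norm.\<close>

lemma comparison_deg: "mazur_comparison J \<Y> E (density J (\<lambda>x. ennreal (dg x))) L (\<lambda>f x. \<bar>f x\<bar>) K"
proof
  fix f assume f: "f \<in> Bd J"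
  obtain b where b: "0 \<le> b" "\<forall>x\<in>space J. \<bar>f x\<bar> \<le> b"
    using Bd_bound[OF f] by blast
  show "(\<lambda>x. \<bar>f x\<bar>) \<in> borel_measurable (density J (\<lambda>x. ennreal (dg x)))"
    using f by (auto simp: Bd_def intro!: borel_measurable_abs)
  show "\<exists>b. \<forall>x\<in>space (density J (\<lambda>x. ennreal (dg x))). \<bar>f x\<bar> \<le> b" using b by auto
  show "\<bar>mazur t f x\<bar> = \<bar>f x\<bar> powr t" if "0 < t" for t x
    using that by (simp add: mazur_def abs_mult sgn_if)
  fix r :: real assume r: "1 \<le> r"
  have g: "(\<lambda>x. \<bar>f x\<bar> powr r) \<in> Bd J"
    using f b r by (auto simp: Bd_def intro!: exI[of _ "b powr r"] powr_mono2)
  define W where "W = (\<lambda>e. (\<Sum>x\<in>eJ e. \<bar>f x\<bar> powr r) powr (1 / r))"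
  show "\<exists>W\<in>borel_measurable E. (\<forall>e\<in>space E. 0 \<le> W e \<and>
      (\<forall>t>1. L (mazur t f) e \<le> t * W e powr (t - 1) * L f e)) \<and>
      lnorm E W r \<le> lnorm (density J (\<lambda>x. ennreal (dg x))) (\<lambda>x. \<bar>f x\<bar>) r"
  proof (intro bexI[of _ W] conjI ballI allI impI)
    show "W \<in> borel_measurable E"
      unfolding W_def using sum_measurable[OF g] by measurable
    have "(\<integral>\<^sup>+e. ennreal (W e powr r) \<partial>E) = (\<integral>\<^sup>+e. ennreal (\<Sum>x\<in>eJ e. \<bar>f x\<bar> powr r) \<partial>E)"
      using r by (simp add: W_def powr_powr sum_nonneg)
    also have "\<dots> = (\<integral>\<^sup>+x. ennreal (dg x * \<bar>f x\<bar> powr r) \<partial>J)"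
      using g by (intro sum_integral) auto
    finally show "lnorm E W r \<le> lnorm (density J (\<lambda>x. ennreal (dg x))) (\<lambda>x. \<bar>f x\<bar>) r"
      unfolding lnorm_density[OF f] by (simp add: lnorm_def deg_norm_def)
    fix e assume e: "e \<in> space E"
    show W0: "0 \<le> W e" by (simp add: W_def)
    have "\<bar>f x\<bar> \<le> W e" if "x \<in> eJ e" for x
    proof -
      have "\<bar>f x\<bar> = (\<bar>f x\<bar> powr r) powr (1 / r)" using r by (simp add: powr_powr)
      also have "\<dots> \<le> W e"
        unfolding W_def using eJ(1)[OF e] that r by (intro powr_mono2 member_le_sum) auto
      finally show ?thesis .
    qed
    then have zero: "H f e u = 0" if "W e < u" for u
      using that W0 by (intro H_zero f e) force+
    show "L (mazur t f) e \<le> t * W e powr (t - 1) * L f e" if "1 < t" for t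
      using L_mazur_upper[OF f e that W0 zero] .
  qed
qed (use adm K_nonneg L_measurable L_mazur_lower L_nonneg in auto)

text \<open>Here \<open>R f\<close> itself serves as \<open>W\<close> for every \<open>r\<close>:
  the profile vanishes beyond it by definition, and the two norms coincide.\<close>

lemma comparison_radius:
  assumes meas: "\<And>f. f \<in> Bd J \<Longrightarrow> R f \<in> borel_measurable E"
    and R: "\<And>f e. f \<in> Bd J \<Longrightarrow> e \<in> space E \<Longrightarrow> R f e = vanishing_radius (H f e)"
  shows "mazur_comparison J \<Y> E E L R K"
proof
  fix f assume f: "f \<in> Bd J"
  obtain b where b: "0 \<le> b" "\<forall>x\<in>space J. \<bar>f x\<bar> \<le> b"
    using Bd_bound[OF f] by blast
  note zero = H_eventually_zero[OF b f]
  show R0: "0 \<le> R f e" if "e \<in> space E" for e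
    using vanishing_radius_nonneg[OF zero[OF that]] R[OF f that] by simp
  have "R f e \<le> b" if "e \<in> space E" for e
    using vanishing_radius_le[OF b(1) zero[OF that]] R[OF f that] by simp
  then show "\<exists>b. \<forall>e\<in>space E. R f e \<le> b" by blast
  show "R (mazur t f) e = R f e powr t" if t: "0 < t" and e: "e \<in> space E" for t e
  proof -
    have g: "mazur t f \<in> Bd J" using mazur_Bd[OF f t] .
    obtain b' where b': "0 \<le> b'" "\<forall>x\<in>space J. \<bar>mazur t f x\<bar> \<le> b'"
      using Bd_bound[OF g] by blast
    show ?thesis
      using vanishing_radius_scale[where h = "H f e" and h' = "H (mazur t f) e", OF zero[OF e] H_eventually_zero[OF b' g e] H_mazur[OF f e t] t] f g e
      by (simp add: R)
  qed
  fix r :: real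
  have "L (mazur t f) e \<le> t * R f e powr (t - 1) * L f e" if "1 < t" "e \<in> space E" for t e
    using vanishing_radius_zero[where h = "H f e", OF zero[OF that(2)]] R[OF f that(2)]
    by (intro L_mazur_upper f that R0) simp
  then show "\<exists>W\<in>borel_measurable E. (\<forall>e\<in>space E. 0 \<le> W e \<and>
      (\<forall>t>1. L (mazur t f) e \<le> t * W e powr (t - 1) * L f e)) \<and> lnorm E W r \<le> lnorm E (R f) r"
    using meas[OF f] R0 by (intro bexI[of _ "R f"]) auto
qed (use adm K_nonneg L_measurable L_mazur_lower L_nonneg meas in auto)

lemma deg_norm_conclusion:
  assumes C: "2 * C = ennreal K" and F: "\<And>p f. F p f = lnorm E (L f) p"
  defines "c \<equiv> (\<lambda>p q. minimax \<Y> (F p) (deg_norm J dg q))"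
    and "\<eta>E \<equiv> emeasure E (space E)" and "D \<equiv> (\<integral>\<^sup>+x. ennreal (dg x) \<partial>J)"
  shows "((\<forall>e\<in>space E. card (eJ e) \<le> 2) \<longrightarrow>
      power_decreasing C c \<and>
      (\<forall>p\<ge>1. \<forall>q\<ge>1. two_sided_bound C c p q) \<and>
      (0 < \<eta>E \<and> \<eta>E < top \<longrightarrow>
        increasing_in_p \<eta>E c \<and> (D \<le> \<eta>E \<longrightarrow> decreasing_in_q \<eta>E c) \<and> decreasing_in_q D c)) \<and>
    two_sided_bound C c 1 1"
proof -
  interpret mc: mazur_comparison J \<Y> E "density J (\<lambda>x. ennreal (dg x))" L "\<lambda>f x. \<bar>f x\<bar>" K
    by (rule comparison_deg)
  have c: "c = mc.c"
    unfolding c_def mc.c_def by (intro ext minimax_cong) (auto simp: F lnorm_density mc.Y_Bd)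
  have D: "emeasure (density J (\<lambda>x. ennreal (dg x))) (space (density J (\<lambda>x. ennreal (dg x)))) = D"
    using dg_measurable by (simp add: emeasure_density D_def cong: nn_integral_cong)
  \<comment> \<open>The degree identity for the constant one gives \<open>D\<close> as the integral
    of \<open>card (eJ e)\<close>, at most twice \<open>\<eta>E\<close>. This supplies the finite
    mass needed in \<open>decreasing_in_q_c\<close>.\<close>
  have "D < top" if "\<eta>E < top" and card: "\<forall>e\<in>space E. card (eJ e) \<le> 2"
  proof -
    have one: "(\<lambda>_. 1) \<in> Bd J" by (auto simp: Bd_def)
    have "D = (\<integral>\<^sup>+e. ennreal (\<Sum>x\<in>eJ e. 1) \<partial>E)"
      using sum_integral[OF one] by (simp add: D_def)
    also have "\<dots> \<le> (\<integral>\<^sup>+e. 2 \<partial>E)"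
    proof (rule nn_integral_mono)
      fix e assume "e \<in> space E"
      then have "ennreal (real (card (eJ e))) \<le> ennreal 2" using card by (intro ennreal_leI) auto
      then show "ennreal (\<Sum>x\<in>eJ e. 1) \<le> 2" by simp
    qed
    also have "\<dots> < top" using that by (simp add: \<eta>E_def ennreal_mult_less_top)
    finally show ?thesis .
  qed
  moreover have "increasing_in_p \<eta>E mc.c" if "0 < \<eta>E" "\<eta>E < top"
    using mc.increasing_in_p_c[of "enn2real \<eta>E"] that by (simp add: \<eta>E_def enn2real_positive_iff)
  ultimately show ?thesis
    unfolding c using mc.power_decreasing_c[OF C] mc.two_sided[OF C] mc.decreasing_in_q_c D
    by (auto intro: le_less_trans)
qed

lemma radius_norm_conclusion:
  assumes C: "2 * C = ennreal K" and F: "\<And>p f. F p f = lnorm E (L f) p" and N: "\<And>q f. N q f = lnorm E (R f) q"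
    and meas: "\<And>f. f \<in> Bd J \<Longrightarrow> R f \<in> borel_measurable E"
    and R: "\<And>f e. f \<in> Bd J \<Longrightarrow> e \<in> space E \<Longrightarrow> R f e = vanishing_radius (H f e)"
  defines "c \<equiv> (\<lambda>p q. minimax \<Y> (F p) (N q))" and "\<eta>E \<equiv> emeasure E (space E)"
  shows "((\<forall>e\<in>space E. card (eJ e) \<le> 2) \<longrightarrow>
      power_decreasing C c \<and>
      (\<forall>p\<ge>1. \<forall>q\<ge>1. two_sided_bound C c p q) \<and>
      (0 < \<eta>E \<and> \<eta>E < top \<longrightarrow> increasing_in_p \<eta>E c \<and> decreasing_in_q \<eta>E c)) \<and>
    two_sided_bound C c 1 1"
proof -
  interpret mc: mazur_comparison J \<Y> E E L R K
    using meas R by (rule comparison_radius)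
  have c: "c = mc.c"
    unfolding c_def mc.c_def by (intro ext minimax_cong) (auto simp: F N)
  have "increasing_in_p \<eta>E mc.c" if "0 < \<eta>E" "\<eta>E < top"
    using mc.increasing_in_p_c[of "enn2real \<eta>E"] that by (simp add: \<eta>E_def enn2real_positive_iff)
  then show ?thesis
    unfolding c using mc.power_decreasing_c[OF C] mc.two_sided[OF C] mc.decreasing_in_q_c[of \<eta>E]
    by (auto simp: \<eta>E_def)
qed

end

section \<open>Profiles of set functions and set-pair functions\<close>

text \<open>\<open>G\<close> is arbitrary; measurability comes from finiteness, because the varying
  set takes values in the finite discrete space \<open>Pow K\<close>, on which every function is
  measurable.\<close>

lemma finite_levels_measurable:
  fixes G :: "'a set \<Rightarrow> real"
  assumes K: "finite K" and P: "\<And>x. x \<in> K \<Longrightarrow> Measurable.pred M (\<lambda>u. P x u)"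
  shows "(\<lambda>u. G {x \<in> K. P x u}) \<in> borel_measurable M"
proof -
  have "(\<lambda>u. {x \<in> K. P x u}) \<in> measurable M (count_space (Pow K))"
  proof (subst measurable_count_space_eq2, simp add: K, intro conjI ballI)
    fix A assume A: "A \<in> Pow K"
    have "(\<lambda>u. {x \<in> K. P x u}) -` {A} \<inter> space M = {u \<in> space M. \<forall>x\<in>K. P x u \<longleftrightarrow> x \<in> A}"
      using A by auto
    also have "\<dots> \<in> sets M"
      using K P by (intro sets.sets_Collect_finite_All) (auto simp: pred_def)
    finally show "(\<lambda>u. {x \<in> K. P x u}) -` {A} \<inter> space M \<in> sets M" .
  qed auto
  then show ?thesis
    by (rule measurable_compose) simp
qed

text \<open>The Mazur map acts on values by a strictly increasing odd function, so levels at
  \<open>u\<close> and \<open>- u\<close> become levels at \<open>u powr t\<close> and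
  \<open>- (u powr t)\<close>. This is the source of \<open>H_mazur\<close>.\<close>

lemma mazur_le_iff:
  assumes "0 < t" "0 < u"
  shows "u powr t \<le> mazur t f x \<longleftrightarrow> u \<le> f x"
    and "- (u powr t) \<le> mazur t f x \<longleftrightarrow> - u \<le> f x"
    and "mazur t f x \<le> - (u powr t) \<longleftrightarrow> f x \<le> - u"
proof -
  have pos: "0 < u powr t" using assms by simp
  have le: "a powr t \<le> b powr t \<longleftrightarrow> a \<le> b" if "0 \<le> a" "0 \<le> b" for a b
    using that assms powr_mono2[of t a b] powr_less_mono2[of t b a] by (auto simp: not_le[symmetric])
  have mz: "mazur t f x = f x powr t" "0 \<le> mazur t f x" if "0 \<le> f x"
    using that by (auto simp: mazur_def sgn_if)
  have mz': "mazur t f x = - ((- f x) powr t)" "mazur t f x \<le> 0" if "f x \<le> 0"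
    using that by (auto simp: mazur_def sgn_if)
  show "u powr t \<le> mazur t f x \<longleftrightarrow> u \<le> f x"
    using le[of u "f x"] mz mz' assms pos by (cases "0 \<le> f x") (simp, linarith)
  show "- (u powr t) \<le> mazur t f x \<longleftrightarrow> - u \<le> f x"
    using le[of "- f x" u] mz mz' assms pos by (cases "0 \<le> f x") (linarith, auto)
  show "mazur t f x \<le> - (u powr t) \<longleftrightarrow> f x \<le> - u"
    using le[of u "- f x"] mz mz' assms pos by (cases "0 \<le> f x") (linarith, auto)
qed

lemma concentrated_level:
  fixes f :: "'j \<Rightarrow> real"
  assumes "concentrated J K \<phi>" "f \<in> borel_measurable J" "K \<subseteq> space J"
  shows "\<phi> {x \<in> space J. u \<le> f x} = \<phi> {x \<in> K. u \<le> f x}"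
proof -
  have [measurable]: "f \<in> borel_measurable J" by fact
  have "{x \<in> space J. u \<le> f x} \<in> sets J" by measurable
  moreover have "{x \<in> space J. u \<le> f x} \<inter> K = {x \<in> K. u \<le> f x}"
    using assms(3) by auto
  ultimately show ?thesis
    using assms(1) by (auto simp: concentrated_def)
qed

text \<open>For \<open>u > 0\<close> the two levels are disjoint, as
  \<open>pair_concentrated\<close> asks; at \<open>u = 0\<close> they may meet where
  \<open>f\<close> vanishes.\<close>

lemma pair_concentrated_level:
  fixes f :: "'j \<Rightarrow> real"
  assumes "pair_concentrated J K \<psi>" "f \<in> borel_measurable J" "K \<subseteq> space J" "0 < u"
  shows "\<psi> {x \<in> space J. u \<le> f x} {x \<in> space J. f x \<le> - u} = \<psi> {x \<in> K. u \<le> f x} {x \<in> K. f x \<le> - u}"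
proof -
  have [measurable]: "f \<in> borel_measurable J" by fact
  let ?A = "{x \<in> space J. u \<le> f x}" and ?B = "{x \<in> space J. f x \<le> - u}"
  have AB: "?A \<in> sets J" "?B \<in> sets J" by measurable
  have "?A \<inter> ?B = {}" using assms(4) by auto
  then have "\<psi> ?A ?B = \<psi> (?A \<inter> K) (?B \<inter> K)"
    using assms(1) AB unfolding pair_concentrated_def by blast
  also have "?A \<inter> K = {x \<in> K. u \<le> f x}" using assms(3) by auto
  also have "?B \<inter> K = {x \<in> K. f x \<le> - u}" using assms(3) by auto
  finally show ?thesis .
qed

text \<open>Below the infimum of \<open>f\<close> the level is the whole space, where
  \<open>\<phi>\<close> is zero. The integral therefore extends to the whole line, whatever the sign
  of the infimum, and folding at \<open>0\<close> adds the values at \<open>u\<close> and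
  \<open>- u\<close>.\<close>

lemma lovasz_eq_half_line:
  assumes f: "f \<in> Bd J" and ne: "space J \<noteq> {}" and \<phi>: "set_function J \<phi>"
    and conc: "concentrated J K \<phi>" and K: "finite K" "K \<subseteq> space J"
    and bound: "\<And>B. B \<in> sets J \<Longrightarrow> \<phi> B \<le> c"
  shows "lovasz J \<phi> f = (LBINT u:{0<..}. \<phi> {x \<in> K. u \<le> f x} + \<phi> {x \<in> K. - u \<le> f x})"
proof -
  obtain b where b: "\<And>x. x \<in> space J \<Longrightarrow> \<bar>f x\<bar> \<le> b" and fm [measurable]: "f \<in> borel_measurable J"
    using f by (auto simp: Bd_def)
  define g where "g = (\<lambda>u. \<phi> {x \<in> K. u \<le> f x})"
  have level: "\<phi> {x \<in> space J. u \<le> f x} = g u" for u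
    unfolding g_def by (rule concentrated_level[OF conc fm K(2)])
  have g_bound: "0 \<le> g u \<and> g u \<le> c" for u
  proof -
    have "{x \<in> space J. u \<le> f x} \<in> sets J" by measurable
    then show ?thesis using \<phi> bound by (auto simp: set_function_def simp flip: level)
  qed
  have g_zero: "g u = 0" if "b < \<bar>u\<bar>" for u
  proof -
    have "{x \<in> space J. u \<le> f x} = {} \<or> {x \<in> space J. u \<le> f x} = space J"
      using that b by (cases "0 < u") force+
    then show ?thesis
      using \<phi> unfolding set_function_def level[symmetric] by metis
  qed
  have [measurable]: "g \<in> borel_measurable borel"
    unfolding g_def by (rule finite_levels_measurable[OF K(1)]) measurable
  have int1: "set_integrable lborel {0<..} g"
    by (rule set_integrable_bounded_support[where c = c and b = b]) (use g_bound g_zero in auto)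
  have int2: "set_integrable lborel {0<..} (\<lambda>u. g (- u))"
    by (rule set_integrable_bounded_support[where c = c and b = b]) (use g_bound g_zero in auto)
  \<comment> \<open>Integrability on the negative half-line is carried over by the reflection of
    \<open>u\<close> to \<open>- u\<close>.\<close>
  then have int3: "set_integrable lborel {..<0} g"
    unfolding set_integrable_def
    by (subst lborel_integrable_real_affine_iff[where c = "-1" and t = 0, symmetric])
      (auto simp: indicator_def cong: if_cong)
  have zero_below: "g u = 0" if "u < Inf (f ` space J)" for u
  proof -
    have "bdd_below (f ` space J)"
      using b by (intro bdd_belowI2[of _ "- b"]) (force simp: abs_le_iff)
    then have "Inf (f ` space J) \<le> f x" if "x \<in> space J" for x
      using that by (intro cINF_lower)
    then have "{x \<in> space J. u \<le> f x} = space J" using that by force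
    then show ?thesis using \<phi> by (simp add: set_function_def flip: level)
  qed
  have "lovasz J \<phi> f = (LBINT t:{Inf (f ` space J)..}. g t)"
    using \<phi> by (simp add: lovasz_def level set_function_def)
  also have "\<dots> = (LBINT t:{..<0} \<union> {0<..}. g t)"
    unfolding set_lebesgue_integral_def
  proof (rule integral_cong_AE)
    have "AE t in lborel. t \<noteq> (0::real)" by (rule AE_lborel_singleton)
    then show "AE t in lborel. indicat_real {Inf (f ` space J)..} t *\<^sub>R g t =
        indicat_real ({..<0} \<union> {0<..}) t *\<^sub>R g t"
      by (rule eventually_mono) (use zero_below in \<open>auto simp: indicator_def\<close>)
  qed auto
  also have "\<dots> = (LBINT t:{..<0}. g t) + (LBINT t:{0<..}. g t)"
    using int1 int3 by (intro set_integral_Un) auto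
  also have "(LBINT t:{..<0}. g t) = (LBINT t:{0<..}. g (- t))"
    by (subst set_integral_reflect) (auto intro!: set_lebesgue_integral_cong arg_cong2[where f = "set_lebesgue_integral lborel"])
  also have "\<dots> + (LBINT t:{0<..}. g t) = (LBINT t:{0<..}. g t + g (- t))"
    using int1 int2 by simp
  finally show ?thesis by (simp add: g_def)
qed

text \<open>The constant is \<open>2 * C\<close> because the profile adds two values of
  \<open>\<phi> e\<close>, each at most \<open>C\<close>.\<close>

lemma level_profile_set_function:
  assumes degree: "degree_related J E eJ dg" and adm: "admissible J \<Y>" and ne: "space J \<noteq> {}"
    and \<phi>: "\<And>e. e \<in> space E \<Longrightarrow> set_function J (\<phi> e)" "\<And>e. e \<in> space E \<Longrightarrow> concentrated J (eJ e) (\<phi> e)"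
    and meas: "\<And>f. f \<in> Bd J \<Longrightarrow> (\<lambda>e. lovasz J (\<phi> e) f) \<in> borel_measurable E"
    and C: "0 \<le> C" "\<And>e B. e \<in> space E \<Longrightarrow> B \<in> sets J \<Longrightarrow> \<phi> e B \<le> C"
  shows "level_profile J E eJ dg \<Y> (\<lambda>f e. lovasz J (\<phi> e) f)
    (\<lambda>f e u. \<phi> e {x \<in> eJ e. u \<le> f x} + \<phi> e {x \<in> eJ e. - u \<le> f x}) (2 * C)"
proof
  fix f e assume f: "f \<in> Bd J" and e: "e \<in> space E"
  have fm [measurable]: "f \<in> borel_measurable J" using f by (simp add: Bd_def)
  have eJ: "finite (eJ e)" "eJ e \<subseteq> space J"
    using degree e by (auto simp: degree_related_def finitely_related_def)
  note level = concentrated_level[OF \<phi>(2)[OF e] fm eJ(2)]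
  show "(\<lambda>u. \<phi> e {x \<in> eJ e. u \<le> f x} + \<phi> e {x \<in> eJ e. - u \<le> f x}) \<in> borel_measurable borel"
    by (intro borel_measurable_add finite_levels_measurable[OF eJ(1)]) measurable
  show "lovasz J (\<phi> e) f = (LBINT u:{0<..}. \<phi> e {x \<in> eJ e. u \<le> f x} + \<phi> e {x \<in> eJ e. - u \<le> f x})"
    using lovasz_eq_half_line[OF f ne \<phi>(1)[OF e] \<phi>(2)[OF e] eJ C(2)[OF e]] .
  fix u :: real assume u: "0 < u"
  have "{x \<in> space J. v \<le> f x} \<in> sets J" for v by measurable
  then have "0 \<le> \<phi> e {x \<in> eJ e. v \<le> f x} \<and> \<phi> e {x \<in> eJ e. v \<le> f x} \<le> C" for v
    unfolding level[symmetric] using \<phi>(1)[OF e] C(2)[OF e] by (auto simp: set_function_def)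
  from this[of u] this[of "- u"]
  show "0 \<le> \<phi> e {x \<in> eJ e. u \<le> f x} + \<phi> e {x \<in> eJ e. - u \<le> f x} \<and>
      \<phi> e {x \<in> eJ e. u \<le> f x} + \<phi> e {x \<in> eJ e. - u \<le> f x} \<le> 2 * C"
    by linarith
  show "\<phi> e {x \<in> eJ e. u powr t \<le> mazur t f x} + \<phi> e {x \<in> eJ e. - (u powr t) \<le> mazur t f x} =
      \<phi> e {x \<in> eJ e. u \<le> f x} + \<phi> e {x \<in> eJ e. - u \<le> f x}" if "0 < t" for t
    using that u by (simp add: mazur_le_iff)
  assume small: "\<forall>x\<in>eJ e. \<bar>f x\<bar> < u"
  have "{x \<in> eJ e. u \<le> f x} = {}" "{x \<in> eJ e. - u \<le> f x} = eJ e"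
    using small by force+
  \<comment> \<open>Concentration transports the value zero from the whole space to
    \<open>eJ e\<close>, which is the level at \<open>- u\<close> when
    \<open>\<bar>f x\<bar> < u\<close> on \<open>eJ e\<close>.\<close>
  moreover have "\<phi> e (space J) = \<phi> e (space J \<inter> eJ e)"
    using \<phi>(2)[OF e] sets.top unfolding concentrated_def by blast
  then have "\<phi> e (eJ e) = 0" "\<phi> e {} = 0"
    using \<phi>(1)[OF e] eJ(2) by (auto simp: set_function_def inf_absorb2)
  ultimately show "\<phi> e {x \<in> eJ e. u \<le> f x} + \<phi> e {x \<in> eJ e. - u \<le> f x} = 0"
    by (simp only: add_0_right)
qed (use assms in auto)

text \<open>A sum of two nonnegative values vanishes exactly when both do, so the two conditions in
  \<open>abs_set\<close> become one on the profile.\<close>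

lemma abs_set_eq_vanishing_radius:
  assumes f: "f \<in> Bd J" and \<phi>: "set_function J \<phi>" "concentrated J K \<phi>" and K: "K \<subseteq> space J"
  shows "abs_set J \<phi> f = vanishing_radius (\<lambda>u. \<phi> {x \<in> K. u \<le> f x} + \<phi> {x \<in> K. - u \<le> f x})"
proof -
  have fm [measurable]: "f \<in> borel_measurable J" using f by (simp add: Bd_def)
  have "{x \<in> space J. v \<le> f x} \<in> sets J" for v by measurable
  then have "0 \<le> \<phi> {x \<in> space J. v \<le> f x}" for v
    using \<phi>(1) by (auto simp: set_function_def)
  then have "\<phi> {x \<in> space J. s \<le> f x} + \<phi> {x \<in> space J. - s \<le> f x} = 0 \<longleftrightarrow>
      \<phi> {x \<in> space J. s \<le> f x} = 0 \<and> \<phi> {x \<in> space J. - s \<le> f x} = 0" for s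
    by (simp add: add_nonneg_eq_0_iff)
  then show ?thesis
    unfolding abs_set_def vanishing_radius_def concentrated_level[OF \<phi>(2) fm K, symmetric] by simp
qed

lemma level_profile_set_pair_function:
  assumes degree: "degree_related J E eJ dg" and adm: "admissible J \<Y>"
    and \<psi>: "\<And>e. e \<in> space E \<Longrightarrow> set_pair_function J (\<psi> e)"
      "\<And>e. e \<in> space E \<Longrightarrow> pair_concentrated J (eJ e) (\<psi> e)"
    and meas: "\<And>f. f \<in> Bd J \<Longrightarrow> (\<lambda>e. pair_lovasz J (\<psi> e) f) \<in> borel_measurable E"
    and C: "0 \<le> C" "\<And>e A B. e \<in> space E \<Longrightarrow> A \<in> sets J \<Longrightarrow> B \<in> sets J \<Longrightarrow> \<psi> e A B \<le> C"
  shows "level_profile J E eJ dg \<Y> (\<lambda>f e. pair_lovasz J (\<psi> e) f)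
    (\<lambda>f e u. \<psi> e {x \<in> eJ e. u \<le> f x} {x \<in> eJ e. f x \<le> - u}) (2 * C)"
proof
  fix f e assume f: "f \<in> Bd J" and e: "e \<in> space E"
  have fm [measurable]: "f \<in> borel_measurable J" using f by (simp add: Bd_def)
  have eJ: "finite (eJ e)" "eJ e \<subseteq> space J"
    using degree e by (auto simp: degree_related_def finitely_related_def)
  note level = pair_concentrated_level[OF \<psi>(2)[OF e] fm eJ(2)]
  \<comment> \<open>The two levels are coded as one subset of \<open>eJ e \<times> UNIV\<close> over
    the booleans, \<open>True\<close> marking the upper level, so that
    \<open>finite_levels_measurable\<close> applies.\<close>
  have "(\<lambda>u. (\<lambda>S. \<psi> e {x. (x, True) \<in> S} {x. (x, False) \<in> S})
      {y \<in> eJ e \<times> UNIV. if snd y then u \<le> f (fst y) else f (fst y) \<le> - u}) \<in> borel_measurable borel"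
  proof (rule finite_levels_measurable)
    show "Measurable.pred borel (\<lambda>u. if snd y then u \<le> f (fst y) else f (fst y) \<le> - u)" for y
      by (cases "snd y") simp_all
  qed (simp add: eJ)
  then show "(\<lambda>u. \<psi> e {x \<in> eJ e. u \<le> f x} {x \<in> eJ e. f x \<le> - u}) \<in> borel_measurable borel"
    by simp
  note [measurable] = this
  define P where "P = (\<lambda>u. \<psi> e {x \<in> space J. u \<le> f x} {x \<in> space J. f x \<le> - u})"
  define Q where "Q = (\<lambda>u. \<psi> e {x \<in> eJ e. u \<le> f x} {x \<in> eJ e. f x \<le> - u})"
  have PQ: "P u = Q u" if "0 < u" for u
    unfolding P_def Q_def by (rule level[OF that])
  have [measurable]: "Q \<in> borel_measurable borel"
    unfolding Q_def by measurable
  \<comment> \<open>At \<open>u = 0\<close> the levels can overlap and \<open>P\<close> may differ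
    from \<open>Q\<close>; this single point is set apart for measurability and is a null set for
    the integral.\<close>
  have "(\<lambda>u. indicat_real {0..} u *\<^sub>R P u) = (\<lambda>u. if u = 0 then P 0 else indicat_real {0<..} u * Q u)"
    using PQ by (auto simp: indicator_def fun_eq_iff)
  also have "\<dots> \<in> borel_measurable lborel" by measurable
  finally have [measurable]: "(\<lambda>u. indicat_real {0..} u *\<^sub>R P u) \<in> borel_measurable lborel" .
  have "(LBINT u:{0..}. P u) = (LBINT u:{0<..}. Q u)"
    unfolding set_lebesgue_integral_def
  proof (rule integral_cong_AE)
    show "AE u in lborel. indicat_real {0..} u *\<^sub>R P u = indicat_real {0<..} u *\<^sub>R Q u"
      using AE_lborel_singleton[of "0::real"]
      by (rule eventually_mono) (use PQ in \<open>auto simp: indicator_def\<close>)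
  qed measurable
  then show "pair_lovasz J (\<psi> e) f = (LBINT u:{0<..}. \<psi> e {x \<in> eJ e. u \<le> f x} {x \<in> eJ e. f x \<le> - u})"
    by (simp add: pair_lovasz_def P_def Q_def)
  fix u :: real assume u: "0 < u"
  have "{x \<in> space J. u \<le> f x} \<in> sets J" "{x \<in> space J. f x \<le> - u} \<in> sets J" by measurable
  then show "0 \<le> \<psi> e {x \<in> eJ e. u \<le> f x} {x \<in> eJ e. f x \<le> - u} \<and>
      \<psi> e {x \<in> eJ e. u \<le> f x} {x \<in> eJ e. f x \<le> - u} \<le> 2 * C"
    unfolding level[OF u, symmetric] using \<psi>(1)[OF e] C(1) C(2)[OF e, of "{x \<in> space J. u \<le> f x}" "{x \<in> space J. f x \<le> - u}"]
    by (auto simp: set_pair_function_def)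
  show "\<psi> e {x \<in> eJ e. u powr t \<le> mazur t f x} {x \<in> eJ e. mazur t f x \<le> - (u powr t)} =
      \<psi> e {x \<in> eJ e. u \<le> f x} {x \<in> eJ e. f x \<le> - u}" if "0 < t" for t
    using that u by (simp add: mazur_le_iff)
  assume small: "\<forall>x\<in>eJ e. \<bar>f x\<bar> < u"
  have "{x \<in> eJ e. u \<le> f x} = {}" "{x \<in> eJ e. f x \<le> - u} = {}"
    using small by force+
  moreover have "\<psi> e {} {} = 0"
    using \<psi>(1)[OF e] by (simp add: set_pair_function_def)
  ultimately show "\<psi> e {x \<in> eJ e. u \<le> f x} {x \<in> eJ e. f x \<le> - u} = 0"
    by (simp only:)
qed (use assms in auto)

lemma abs_pair_eq_vanishing_radius:
  assumes f: "f \<in> Bd J" and \<psi>: "pair_concentrated J K \<psi>" and K: "K \<subseteq> space J"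
  shows "abs_pair J \<psi> f = vanishing_radius (\<lambda>u. \<psi> {x \<in> K. u \<le> f x} {x \<in> K. f x \<le> - u})"
proof -
  have fm: "f \<in> borel_measurable J" using f by (simp add: Bd_def)
  have "{t. t > 0 \<and> (\<forall>s\<ge>t. \<psi> {x \<in> space J. f x \<ge> s} {x \<in> space J. f x \<le> - s} = 0)} =
      {t. t > 0 \<and> (\<forall>s\<ge>t. \<psi> {x \<in> K. s \<le> f x} {x \<in> K. f x \<le> - s} = 0)}"
    by (intro Collect_cong conj_cong refl all_cong) (simp add: pair_concentrated_level[OF \<psi> fm K])
  then show ?thesis
    by (simp add: abs_pair_def vanishing_radius_def)
qed

section \<open>Assembly for both kinds of functions and both norms\<close>

theorem theorem4p12:
  fixes J :: "'j measure" and E :: "'e measure" and eJ :: "'e \<Rightarrow> 'j set"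
    and dg :: "'j \<Rightarrow> real" and \<Y> :: "('j \<Rightarrow> real) set set"
  assumes "finite_measure J" and "0 < emeasure J (space J)"
    and "degree_related J E eJ dg"
    and "admissible J \<Y>"
  shows
    "let \<eta>E = emeasure E (space E);
         D = (\<integral>\<^sup>+x. ennreal (dg x) \<partial>J);
         card2 = (\<forall>e\<in>space E. card (eJ e) \<le> 2)
     in
     (\<forall>\<phi>.
        (\<forall>e\<in>space E. set_function J (\<phi> e) \<and> concentrated J (eJ e) (\<phi> e)) \<and>
        (\<forall>f\<in>Bd J. (\<lambda>e. lovasz J (\<phi> e) f) \<in> borel_measurable E) \<and>
        C_Phi J E \<phi> < top \<longrightarrow>
        (let C = C_Phi J E \<phi>;
             c = (\<lambda>p q. minimax \<Y> (Phi J E \<phi> p) (deg_norm J dg q))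
         in (card2 \<longrightarrow>
               power_decreasing C c \<and>
               (\<forall>p\<ge>1. \<forall>q\<ge>1. two_sided_bound C c p q) \<and>
               (0 < \<eta>E \<and> \<eta>E < top \<longrightarrow>
                  increasing_in_p \<eta>E c \<and>
                  (D \<le> \<eta>E \<longrightarrow> decreasing_in_q \<eta>E c) \<and> decreasing_in_q D c)) \<and>
            two_sided_bound C c 1 1) \<and>
        ((\<forall>f\<in>Bd J. (\<lambda>e. abs_set J (\<phi> e) f) \<in> borel_measurable E) \<longrightarrow>
         (let C = C_Phi J E \<phi>;
              c = (\<lambda>p q. minimax \<Y> (Phi J E \<phi> p) (set_norm J E \<phi> q))
          in (card2 \<longrightarrow>
                power_decreasing C c \<and>
                (\<forall>p\<ge>1. \<forall>q\<ge>1. two_sided_bound C c p q) \<and>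
                (0 < \<eta>E \<and> \<eta>E < top \<longrightarrow> increasing_in_p \<eta>E c \<and> decreasing_in_q \<eta>E c)) \<and>
             two_sided_bound C c 1 1)))
     \<and>
     (\<forall>\<psi>.
        (\<forall>e\<in>space E. set_pair_function J (\<psi> e) \<and> pair_concentrated J (eJ e) (\<psi> e)) \<and>
        (\<forall>f\<in>Bd J. (\<lambda>e. pair_lovasz J (\<psi> e) f) \<in> borel_measurable E) \<and>
        C_Psi J E \<psi> < top \<longrightarrow>
        (let C = C_Psi J E \<psi>;
             c = (\<lambda>p q. minimax \<Y> (Psi J E \<psi> p) (deg_norm J dg q))
         in (card2 \<longrightarrow>
               power_decreasing C c \<and>
               (\<forall>p\<ge>1. \<forall>q\<ge>1. two_sided_bound C c p q) \<and>
               (0 < \<eta>E \<and> \<eta>E < top \<longrightarrow>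
                  increasing_in_p \<eta>E c \<and>
                  (D \<le> \<eta>E \<longrightarrow> decreasing_in_q \<eta>E c) \<and> decreasing_in_q D c)) \<and>
            two_sided_bound C c 1 1) \<and>
        ((\<forall>f\<in>Bd J. (\<lambda>e. abs_pair J (\<psi> e) f) \<in> borel_measurable E) \<longrightarrow>
         (let C = C_Psi J E \<psi>;
              c = (\<lambda>p q. minimax \<Y> (Psi J E \<psi> p) (pair_norm J E \<psi> q))
          in (card2 \<longrightarrow>
                power_decreasing C c \<and>
                (\<forall>p\<ge>1. \<forall>q\<ge>1. two_sided_bound C c p q) \<and>
                (0 < \<eta>E \<and> \<eta>E < top \<longrightarrow> increasing_in_p \<eta>E c \<and> decreasing_in_q \<eta>E c)) \<and>
             two_sided_bound C c 1 1)))"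
proof -
  define \<eta>E D card2 where "\<eta>E = emeasure E (space E)" and "D = (\<integral>\<^sup>+x. ennreal (dg x) \<partial>J)"
    and "card2 = (\<forall>e\<in>space E. card (eJ e) \<le> 2)"
  have ne: "space J \<noteq> {}" using assms(2) by auto
  have eJ: "e \<in> space E \<Longrightarrow> eJ e \<subseteq> space J" for e
    using assms(3) by (auto simp: degree_related_def finitely_related_def)
  have set_part: "((card2 \<longrightarrow>
        power_decreasing C c \<and> (\<forall>p\<ge>1. \<forall>q\<ge>1. two_sided_bound C c p q) \<and>
        (0 < \<eta>E \<and> \<eta>E < top \<longrightarrow>
          increasing_in_p \<eta>E c \<and> (D \<le> \<eta>E \<longrightarrow> decreasing_in_q \<eta>E c) \<and> decreasing_in_q D c)) \<and>
        two_sided_bound C c 1 1) \<and>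
      ((\<forall>f\<in>Bd J. (\<lambda>e. abs_set J (\<phi> e) f) \<in> borel_measurable E) \<longrightarrow>
        (card2 \<longrightarrow>
          power_decreasing C c' \<and> (\<forall>p\<ge>1. \<forall>q\<ge>1. two_sided_bound C c' p q) \<and>
          (0 < \<eta>E \<and> \<eta>E < top \<longrightarrow> increasing_in_p \<eta>E c' \<and> decreasing_in_q \<eta>E c')) \<and>
        two_sided_bound C c' 1 1)"
    if H: "(\<forall>e\<in>space E. set_function J (\<phi> e) \<and> concentrated J (eJ e) (\<phi> e)) \<and>
        (\<forall>f\<in>Bd J. (\<lambda>e. lovasz J (\<phi> e) f) \<in> borel_measurable E) \<and> C_Phi J E \<phi> < top"
      and defs: "C = C_Phi J E \<phi>" "c = (\<lambda>p q. minimax \<Y> (Phi J E \<phi> p) (deg_norm J dg q))"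
        "c' = (\<lambda>p q. minimax \<Y> (Phi J E \<phi> p) (set_norm J E \<phi> q))"
    for \<phi> C c c'
  proof -
    define r where "r = enn2real C"
    have r: "C = ennreal r" "0 \<le> r" using H by (auto simp: r_def defs)
    have bound: "\<phi> e B \<le> r" if "e \<in> space E" "B \<in> sets J" for e B
    proof -
      have "ennreal \<bar>\<phi> e B\<bar> \<le> ennreal r"
        unfolding r(1)[symmetric] defs(1) C_Phi_def by (rule SUP_upper2[OF that(1)]) (rule SUP_upper[OF that(2)])
      then show ?thesis using r(2) by (simp add: ennreal_le_iff)
    qed
    interpret level_profile J E eJ dg \<Y> "\<lambda>f e. lovasz J (\<phi> e) f"
      "\<lambda>f e u. \<phi> e {x \<in> eJ e. u \<le> f x} + \<phi> e {x \<in> eJ e. - u \<le> f x}" "2 * r"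
      using H r bound by (intro level_profile_set_function assms(3,4) ne) blast+
    have C: "2 * C = ennreal (2 * r)" using r by (simp add: ennreal_mult)
    have F: "Phi J E \<phi> p f = lnorm E (\<lambda>e. lovasz J (\<phi> e) f) p" for p f
      by (simp add: Phi_def lnorm_def)
    have N: "set_norm J E \<phi> q f = lnorm E (\<lambda>e. abs_set J (\<phi> e) f) q" for q f
      by (simp add: set_norm_def lnorm_def)
    have R: "abs_set J (\<phi> e) f = vanishing_radius (\<lambda>u. \<phi> e {x \<in> eJ e. u \<le> f x} + \<phi> e {x \<in> eJ e. - u \<le> f x})"
      if "f \<in> Bd J" "e \<in> space E" for f e
      using H that eJ by (intro abs_set_eq_vanishing_radius) auto
    show ?thesis
      unfolding defs(2,3) \<eta>E_def D_def card2_def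
      using deg_norm_conclusion[OF C F] radius_norm_conclusion[OF C F N _ R] by blast
  qed
  have pair_part: "((card2 \<longrightarrow>
        power_decreasing C c \<and> (\<forall>p\<ge>1. \<forall>q\<ge>1. two_sided_bound C c p q) \<and>
        (0 < \<eta>E \<and> \<eta>E < top \<longrightarrow>
          increasing_in_p \<eta>E c \<and> (D \<le> \<eta>E \<longrightarrow> decreasing_in_q \<eta>E c) \<and> decreasing_in_q D c)) \<and>
        two_sided_bound C c 1 1) \<and>
      ((\<forall>f\<in>Bd J. (\<lambda>e. abs_pair J (\<psi> e) f) \<in> borel_measurable E) \<longrightarrow>
        (card2 \<longrightarrow>
          power_decreasing C c' \<and> (\<forall>p\<ge>1. \<forall>q\<ge>1. two_sided_bound C c' p q) \<and>
          (0 < \<eta>E \<and> \<eta>E < top \<longrightarrow> increasing_in_p \<eta>E c' \<and> decreasing_in_q \<eta>E c')) \<and>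
        two_sided_bound C c' 1 1)"
    if H: "(\<forall>e\<in>space E. set_pair_function J (\<psi> e) \<and> pair_concentrated J (eJ e) (\<psi> e)) \<and>
        (\<forall>f\<in>Bd J. (\<lambda>e. pair_lovasz J (\<psi> e) f) \<in> borel_measurable E) \<and> C_Psi J E \<psi> < top"
      and defs: "C = C_Psi J E \<psi>" "c = (\<lambda>p q. minimax \<Y> (Psi J E \<psi> p) (deg_norm J dg q))"
        "c' = (\<lambda>p q. minimax \<Y> (Psi J E \<psi> p) (pair_norm J E \<psi> q))"
    for \<psi> C c c'
  proof -
    define r where "r = enn2real C"
    have r: "C = ennreal r" "0 \<le> r" using H by (auto simp: r_def defs)
    have bound: "\<psi> e A B \<le> r" if "e \<in> space E" "A \<in> sets J" "B \<in> sets J" for e A B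
    proof -
      have "ennreal \<bar>\<psi> e A B\<bar> \<le> ennreal r"
        unfolding r(1)[symmetric] defs(1) C_Psi_def
        by (rule SUP_upper2[OF that(1)], rule SUP_upper2[OF that(2)]) (rule SUP_upper[OF that(3)])
      then show ?thesis using r(2) by (simp add: ennreal_le_iff)
    qed
    interpret level_profile J E eJ dg \<Y> "\<lambda>f e. pair_lovasz J (\<psi> e) f"
      "\<lambda>f e u. \<psi> e {x \<in> eJ e. u \<le> f x} {x \<in> eJ e. f x \<le> - u}" "2 * r"
      using H r bound by (intro level_profile_set_pair_function assms(3,4)) blast+
    have C: "2 * C = ennreal (2 * r)" using r by (simp add: ennreal_mult)
    have F: "Psi J E \<psi> p f = lnorm E (\<lambda>e. pair_lovasz J (\<psi> e) f) p" for p f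
      by (simp add: Psi_def lnorm_def)
    have N: "pair_norm J E \<psi> q f = lnorm E (\<lambda>e. abs_pair J (\<psi> e) f) q" for q f
      by (simp add: pair_norm_def lnorm_def)
    have R: "abs_pair J (\<psi> e) f = vanishing_radius (\<lambda>u. \<psi> e {x \<in> eJ e. u \<le> f x} {x \<in> eJ e. f x \<le> - u})"
      if "f \<in> Bd J" "e \<in> space E" for f e
      using H that eJ by (intro abs_pair_eq_vanishing_radius) auto
    show ?thesis
      unfolding defs(2,3) \<eta>E_def D_def card2_def
      using deg_norm_conclusion[OF C F] radius_norm_conclusion[OF C F N _ R] by blast
  qed
  show ?thesis
    unfolding Let_def
    \<comment> \<open>This instance of \<open>conjI\<close> splits only the conjunction of the two
      universal statements; the inner conjunctions stay whole and match \<open>set_part\<close> and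
      \<open>pair_part\<close>.\<close>
    by (intro conjI[of "\<forall>x. P x" "\<forall>x. Q x" for P Q] allI impI
        set_part[OF _ refl refl refl, unfolded \<eta>E_def D_def card2_def]
        pair_part[OF _ refl refl refl, unfolded \<eta>E_def D_def card2_def])
qed

end
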